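(* Let $d\ge2$, $1<a<b<\infty$, $\psi\in\Psi(a,b)$, and suppose that the set $E=\{q\ge1:\ \exists\, p\in(a,b)\text{ with }K_d(p,q)<\infty\}$ is nonempty. For $q\in E$ put $$\zeta(q)=\inf_{p\in(a,b)}\big[\psi(p)\,K_d(p,q)\big].$$ Then for every $f\in G\psi(\mathbb{R}^d)$, $$\|\hat f\|_{G\zeta,\,S(d-1)}\le 1\times\|f\|_{G\psi(\mathbb{R}^d)},$$ and the constant $1$ is best possible, i.e. it cannot be replaced by a smaller constant valid for all such $(a,b)$, $\psi$ and $f$.
   Context: For an integrable function $f$ on $\mathbb{R}^d$ the Fourier transform is $\hat f(k)=\int_{\mathbb{R}^d}e^{-i(k,x)}f(x)\,dx$. $S(d-1)=\{x\in\mathbb{R}^d:|x|=1\}$ is the unit sphere with surface measure $\gamma$; $\|f\|_p=\left(\int_{\mathbb{R}^d}|f|^p\,dx\right)^{1/p}$ and $\|g\|_{L_q(S(d-1))}=\left(\int_{S(d-1)}|g|^q\,d\gamma\right)^{1/q}$. The restriction constant is $$K_d(p,q)=\sup\left\{\frac{\|\hat f\|_{L_q(S(d-1))}}{\|f\|_p}:\ f\in L_1(\mathbb{R}^d)\cap L_p(\mathbb{R}^d),\ f\neq0\right\}\in[0,+\infty],\qquad p,q\ge1.$$ $\Psi(a,b)$ is the set of measurable functions $\psi:(a,b)\to(0,\infty)$ with $\inf_{p\in(a,b)}\psi(p)>0$. The Grand Lebesgue Space $G\psi(\mathbb{R}^d)$ consists of all integrable functions $f$ on $\mathbb{R}^d$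 with finite norm $\|f\|_{G\psi(\mathbb{R}^d)}=\sup_{p\in(a,b)}\|f\|_p/\psi(p)$. On the sphere, for the function $\zeta:E\to(0,\infty)$, the corresponding norm is $\|g\|_{G\zeta,\,S(d-1)}=\sup_{q\in E}\|g\|_{L_q(S(d-1))}/\zeta(q)$. *)

theory Defs
  imports "HOL-Analysis.Analysis"
begin

(* Only used for exponents r > 0, where it is the usual power on [0,\<infinity>]. *)
definition ennreal_powr :: "ennreal \<Rightarrow> real \<Rightarrow> ennreal" where
  "ennreal_powr x r = (if x = \<infinity> then \<infinity> else ennreal (enn2real x powr r))"

definition Lp_norm :: "'a measure \<Rightarrow> real \<Rightarrow> ('a \<Rightarrow> complex) \<Rightarrow> ennreal" where
  "Lp_norm M p f = ennreal_powr (\<integral>\<^sup>+x. ennreal (norm (f x) powr p) \<partial>M) (1 / p)"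

definition fourier :: "('a::euclidean_space \<Rightarrow> complex) \<Rightarrow> 'a \<Rightarrow> complex" where
  "fourier f k = (LINT x|lebesgue. exp (- (\<i> * complex_of_real (k \<bullet> x))) * f x)"

(* The surface measure on the Borel sets of the unit sphere: the surface measure of A is d times
   the volume of the cone {r x | x \<in> A, 0 < r \<le> 1}, i.e. the measure for which integration in polar
   coordinates has density r^(d-1); see emeasure_sphere_measure below. *)
definition sphere_measure :: "'a::euclidean_space measure" where
  "sphere_measure =
     scale_measure (of_nat DIM('a))
       (distr (restrict_space lborel (cball 0 1 - {0})) (restrict_space borel (sphere 0 1)) sgn)"

lemma space_sphere_measure: "space sphere_measure = sphere 0 1"
  by (simp add: sphere_measure_def space_scale_measure space_restrict_space)

lemma sets_sphere_measure: "sets sphere_measure = sets (restrict_space borel (sphere 0 1))"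
  by (simp add: sphere_measure_def)

lemma emeasure_sphere_measure:
  fixes A :: "'a::euclidean_space set"
  assumes "A \<in> sets borel" "A \<subseteq> sphere 0 1"
  shows "emeasure sphere_measure A =
           of_nat DIM('a) * emeasure lborel {r *\<^sub>R x | r x. x \<in> A \<and> 0 < r \<and> r \<le> 1}"
proof -
  let ?B = "cball 0 1 - {0} :: 'a set"
  have A: "A \<in> sets (restrict_space borel (sphere 0 1))"
    using assms by (simp add: sets_restrict_space_iff)
  have "(sgn :: 'a \<Rightarrow> 'a) \<in> borel_measurable lborel"
    unfolding sgn_div_norm by simp
  then have "sgn \<in> borel_measurable (restrict_space lborel ?B)"
    by (rule measurable_restrict_space1)
  then have m: "sgn \<in> measurable (restrict_space lborel ?B) (restrict_space borel (sphere 0 1))"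
    by (intro measurable_restrict_space2) (auto simp: space_restrict_space norm_sgn)
  have "sgn -` A \<inter> ?B = {r *\<^sub>R x | r x. x \<in> A \<and> 0 < r \<and> r \<le> 1}" (is "?L = ?R")
  proof (intro equalityI subsetI)
    fix y assume "y \<in> ?L"
    then show "y \<in> ?R"
      by (intro CollectI exI[of _ "norm y"] exI[of _ "sgn y"]) (auto simp: sgn_div_norm)
  next
    fix y assume "y \<in> ?R"
    then obtain r x where y: "y = r *\<^sub>R x" "x \<in> A" "0 < r" "r \<le> 1" by blast
    then have "norm x = 1" using assms(2) by auto
    with y show "y \<in> ?L" by (auto simp: sgn_div_norm)
  qed
  moreover have "emeasure (restrict_space lborel ?B) (sgn -` A \<inter> ?B) = emeasure lborel (sgn -` A \<inter> ?B)"
    by (rule emeasure_restrict_space) auto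
  ultimately show ?thesis
    by (simp add: sphere_measure_def emeasure_distr[OF m A] space_restrict_space)
qed

definition restriction_const :: "'a::euclidean_space itself \<Rightarrow> real \<Rightarrow> real \<Rightarrow> ennreal" where
  "restriction_const _ p q =
     (SUP f \<in> {f :: 'a \<Rightarrow> complex. integrable lebesgue f \<and> Lp_norm lebesgue p f < \<infinity>
                 \<and> \<not> (AE x in lebesgue. f x = 0)}.
        Lp_norm sphere_measure q (fourier f) / Lp_norm lebesgue p f)"

definition Psi :: "real \<Rightarrow> real \<Rightarrow> (real \<Rightarrow> real) set" where
  "Psi a b = {\<psi>. \<psi> \<in> borel_measurable (lebesgue_on {a<..<b}) \<and> (\<forall>p\<in>{a<..<b}. 0 < \<psi> p)
                  \<and> 0 < (INF p\<in>{a<..<b}. \<psi> p)}"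

definition grand_norm ::
    "'a measure \<Rightarrow> real set \<Rightarrow> (real \<Rightarrow> ennreal) \<Rightarrow> ('a \<Rightarrow> complex) \<Rightarrow> ennreal" where
  "grand_norm M E \<phi> f = (SUP p\<in>E. Lp_norm M p f / \<phi> p)"

definition gls_norm ::
    "real \<Rightarrow> real \<Rightarrow> (real \<Rightarrow> real) \<Rightarrow> ('a::euclidean_space \<Rightarrow> complex) \<Rightarrow> ennreal" where
  "gls_norm a b \<psi> = grand_norm lebesgue {a<..<b} (\<lambda>p. ennreal (\<psi> p))"

definition GLS :: "real \<Rightarrow> real \<Rightarrow> (real \<Rightarrow> real) \<Rightarrow> ('a::euclidean_space \<Rightarrow> complex) set" where
  "GLS a b \<psi> = {f. integrable lebesgue f \<and> gls_norm a b \<psi> f < \<infinity>}"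

definition restriction_exponents ::
    "'a::euclidean_space itself \<Rightarrow> real \<Rightarrow> real \<Rightarrow> real set" where
  "restriction_exponents T a b = {q. 1 \<le> q \<and> (\<exists>p\<in>{a<..<b}. restriction_const T p q < \<infinity>)}"

definition zeta ::
    "'a::euclidean_space itself \<Rightarrow> real \<Rightarrow> real \<Rightarrow> (real \<Rightarrow> real) \<Rightarrow> real \<Rightarrow> ennreal" where
  "zeta T a b \<psi> q = (INF p\<in>{a<..<b}. ennreal (\<psi> p) * restriction_const T p q)"

definition sphere_gls_norm ::
    "real \<Rightarrow> real \<Rightarrow> (real \<Rightarrow> real) \<Rightarrow> ('a::euclidean_space \<Rightarrow> complex) \<Rightarrow> ennreal" where
  "sphere_gls_norm a b \<psi> =
     grand_norm sphere_measure (restriction_exponents TYPE('a) a b) (zeta TYPE('a) a b \<psi>)"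

end

theory Submission
  imports Defs
begin

text \<open>
  The inequality is formal. If \<open>G\<close> is the grand norm of \<open>f\<close>, then \<open>\<parallel>f\<parallel>\<^sub>p \<le> G * \<psi> p\<close> for every \<open>p\<close>, and
  the definition of the restriction constant turns this into \<open>\<parallel>fourier f\<parallel>\<^sub>q \<le> G * \<psi> p * K p q\<close>. Taking
  the infimum over \<open>p\<close> gives \<open>G * zeta q\<close> (\<open>grand_norm_fourier_le\<close>).

  For sharpness, suppose that \<open>K p0 q\<close> is finite for some \<open>p0 > 1\<close>. It is positive
  (\<open>restriction_const_pos\<close>), so it is nearly attained, and by truncation it is nearly attained by a
  bounded function \<open>f\<close> (\<open>bounded_near_extremizer\<close>). A weight \<open>\<psi>\<close> that equals \<open>\<parallel>f\<parallel>\<^sub>p\<^sub>0\<close> at \<open>p0\<close> and is a large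
  constant elsewhere makes the quotient of the two grand norms of \<open>f\<close> as close to 1 as desired
  (\<open>grand_norm_fourier_sharp\<close>).

  This argument would be void if \<open>K p q\<close> were infinite for all \<open>p > 1\<close>. The analytic content
  is therefore a Fourier restriction theorem, of which one exponent is enough
  (\<open>restriction_const_finite\<close>). It is obtained for \<open>q = 2\<close> by the \<open>T T*\<close> method: the integral of
  \<open>|fourier f|\<^sup>2\<close> over the sphere is a double integral of \<open>f x * cnj (f y)\<close> against the Fourier transform
  of the surface measure at \<open>x - y\<close> (\<open>fourier_square_integral_le\<close>), and Young's inequality
  (\<open>nn_integral_convolution_form_le\<close>) bounds it by \<open>\<parallel>f\<parallel>\<^sub>p\<^sup>2\<close> as soon as that transform lies in some
  \<open>L\<^sup>r\<close> with \<open>r\<close> finite. Any power decay of the transform suffices for this, and the rate \<open>1/3\<close> follows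
  from an integration by parts along lines (\<open>cone_kernel_decay\<close>): the surface measure is the image
  of Lebesgue measure on the ball under \<open>sgn\<close>, and along the part inside the ball of a line that
  misses the origin, the direction \<open>sgn y\<close> turns at a rate bounded below.
\<close>

section \<open>Averaging along lines\<close>

lemma nn_integral_lborel_translate:
  fixes f :: "'a::euclidean_space \<Rightarrow> ennreal"
  assumes [measurable]: "f \<in> borel_measurable borel"
  shows "(\<integral>\<^sup>+y. f (v + y) \<partial>lborel) = (\<integral>\<^sup>+y. f y \<partial>lborel)"
  by (subst lborel_distr_plus[of v, symmetric]) (simp add: nn_integral_distr)

text \<open>
  Translations preserve Lebesgue measure, so an integral over the whole space may be computed by
  first averaging the integrand along segments parallel to an arbitrary vector \<open>e\<close>. This takes
  the place of rotating \<open>e\<close> onto a coordinate axis and integrating in that coordinate.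
\<close>
lemma nn_integral_line_average:
  fixes f :: "'a::euclidean_space \<Rightarrow> ennreal"
  assumes [measurable]: "f \<in> borel_measurable borel" "I \<in> sets borel"
  shows "emeasure lborel I * (\<integral>\<^sup>+y. f y \<partial>lborel)
    = (\<integral>\<^sup>+y. (\<integral>\<^sup>+t. indicator I t * f (t *\<^sub>R e + y) \<partial>lborel) \<partial>lborel)"
proof -
  have "(\<integral>\<^sup>+y. (\<integral>\<^sup>+t. indicator I t * f (t *\<^sub>R e + y) \<partial>lborel) \<partial>lborel)
      = (\<integral>\<^sup>+(t::real). (\<integral>\<^sup>+y. indicator I t * f (t *\<^sub>R e + y) \<partial>lborel) \<partial>lborel)"
    by (rule lborel_pair.Fubini') measurable
  also have "\<dots> = (\<integral>\<^sup>+(t::real). indicator I t * (\<integral>\<^sup>+y. f y \<partial>lborel) \<partial>lborel)"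
    by (subst nn_integral_cmult) (simp_all add: nn_integral_lborel_translate)
  also have "\<dots> = emeasure lborel I * (\<integral>\<^sup>+y. f y \<partial>lborel)"
    by (simp add: nn_integral_multc)
  finally show ?thesis ..
qed

text \<open>
  The same averaging for complex integrands, where cancellation along the segment survives.
\<close>
lemma integral_line_average:
  fixes g :: "'a::euclidean_space \<Rightarrow> complex"
  assumes g: "integrable lborel g" and "a \<le> b"
  shows "(b - a) *\<^sub>R (LINT y|lborel. g y)
    = (LINT y|lborel. (LINT t:{a..b}|lborel. g (t *\<^sub>R e + y)))"
proof -
  have [measurable]: "g \<in> borel_measurable borel"
    using g by simp
  define h where "h = (\<lambda>(t, y). indicator {a..b} t *\<^sub>R g (t *\<^sub>R e + y))"
  have h_meas: "h \<in> borel_measurable (lborel \<Otimes>\<^sub>M lborel)"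
    unfolding h_def by measurable
  have tr: "integrable lborel (\<lambda>y. g (v + y))" "(LINT y|lborel. g (v + y)) = (LINT y|lborel. g y)"
    "(LINT y|lborel. norm (g (v + y))) = (LINT y|lborel. norm (g y))" for v
  proof -
    show "integrable lborel (\<lambda>y. g (v + y))"
      using g by (subst (asm) lborel_distr_plus[of v, symmetric]) (simp add: integrable_distr_eq)
    show "(LINT y|lborel. g (v + y)) = (LINT y|lborel. g y)"
      "(LINT y|lborel. norm (g (v + y))) = (LINT y|lborel. norm (g y))"
      by (subst (2) lborel_distr_plus[of v, symmetric], simp add: integral_distr)+
  qed
  have "integrable (lborel \<Otimes>\<^sub>M lborel) h"
  proof (rule lborel_pair.Fubini_integrable[OF h_meas])
    have "integrable lborel (\<lambda>t. indicator {a..b} t * (LINT y|lborel. norm (g y)))"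
      by (intro integrable_mult_left) (simp add: integrable_indicator_iff emeasure_lborel_Icc_eq)
    then show "integrable lborel (\<lambda>t. LINT y|lborel. norm (h (t, y)))"
      by (simp add: h_def tr)
    show "AE t in lborel. integrable lborel (\<lambda>y. h (t, y))"
      by (simp add: h_def tr)
  qed
  then have "(LINT y|lborel. (LINT t|lborel. h (t, y))) = (LINT t|lborel. (LINT y|lborel. h (t, y)))"
    using lborel_pair.Fubini_integral[of "\<lambda>t y. h (t, y)"] by simp
  also have "\<dots> = (b - a) *\<^sub>R (LINT y|lborel. g y)"
    using \<open>a \<le> b\<close> by (simp add: h_def tr)
  finally show ?thesis
    by (simp add: h_def set_lebesgue_integral_def)
qed

section \<open>Decay of the Fourier transform of the surface measure\<close>

text \<open>
  The restriction of the angle function \<open>y \<mapsto> e \<bullet> sgn y\<close> to a line at distance \<open>\<rho>\<close> from the origin is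
  \<open>\<phi>(t) = t / sqrt (t\<^sup>2 + \<rho>\<^sup>2)\<close>. Its derivative \<open>\<rho>\<^sup>2 / (t\<^sup>2 + \<rho>\<^sup>2) powr (3/2)\<close> is at least \<open>\<rho>\<^sup>2\<close> inside the unit
  ball, and \<open>1 / \<phi>'\<close> has derivative at most \<open>3 / \<rho>\<^sup>2\<close> there. One integration by parts therefore
  gains the factor \<open>1 / (lam * \<rho>\<^sup>2)\<close>.
\<close>
lemma oscillatory_integral_bound:
  fixes lam \<rho> l r :: real
  assumes "lam > 0" "\<rho> > 0" "l \<le> r" and bd: "\<And>t. t \<in> {l..r} \<Longrightarrow> t\<^sup>2 + \<rho>\<^sup>2 \<le> 1"
  shows "norm (integral {l..r} (\<lambda>t. exp (- (\<i> * complex_of_real (lam * (t / sqrt (t\<^sup>2 + \<rho>\<^sup>2)))))))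
           \<le> 8 / (lam * \<rho>\<^sup>2)"
proof -
  define q where "q t = sqrt (t\<^sup>2 + \<rho>\<^sup>2)" for t
  define E where "E t = exp (- (\<i> * complex_of_real (lam * (t / q t))))" for t
  \<comment> \<open>\<open>h\<close> is the reciprocal of the derivative of the phase, and \<open>\<i> * h * E\<close> below is an
    approximate antiderivative of \<open>E\<close> with error \<open>R\<close>.\<close>
  define h where "h t = q t ^ 3 / (lam * \<rho>\<^sup>2)" for t
  have q_pos: "q t > 0" for t
    using \<open>\<rho> > 0\<close> by (simp add: q_def add_nonneg_pos)
  have q_sq: "(q t)\<^sup>2 = t\<^sup>2 + \<rho>\<^sup>2" for t
    by (simp add: q_def)
  have nE: "norm (E t) = 1" for t
    by (simp add: E_def)
  have q_le: "q t \<le> 1" and t_le: "\<bar>t\<bar> \<le> 1" if "t \<in> {l..r}" for t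
  proof -
    show "q t \<le> 1" using bd[OF that] by (simp add: q_def)
    have "t\<^sup>2 \<le> 1" using bd[OF that] zero_le_power2[of \<rho>] by linarith
    then show "\<bar>t\<bar> \<le> 1" by (simp add: abs_square_le_1)
  qed
  have dq: "(q has_real_derivative t / q t) (at t)" for t
    using q_pos[of t] unfolding q_def
    by (auto intro!: derivative_eq_intros simp: field_simps)
  have dphi: "((\<lambda>t. t / q t) has_real_derivative \<rho>\<^sup>2 / q t ^ 3) (at t)" for t
  proof -
    have "((\<lambda>t. t / q t) has_real_derivative (1 * q t - t * (t / q t)) / (q t * q t)) (at t)"
      using q_pos[of t] by (intro derivative_intros dq) auto
    moreover have "(1 * q t - t * (t / q t)) / (q t * q t) = ((q t)\<^sup>2 - t\<^sup>2) / q t ^ 3"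
      using q_pos[of t] by (simp add: field_simps power2_eq_square power3_eq_cube)
    ultimately show ?thesis by (simp add: q_sq)
  qed
  have dh: "(h has_real_derivative 3 * t * q t / (lam * \<rho>\<^sup>2)) (at t)" for t
  proof -
    have "(h has_real_derivative (3 * (q t)\<^sup>2 * (t / q t)) / (lam * \<rho>\<^sup>2)) (at t)"
      unfolding h_def using \<open>lam > 0\<close> \<open>\<rho> > 0\<close>
      by (auto intro!: derivative_eq_intros dq)
    then show ?thesis
      using q_pos[of t] by (simp add: power2_eq_square mult_ac)
  qed
  have dE: "(E has_vector_derivative - \<i> * complex_of_real (lam * (\<rho>\<^sup>2 / q t ^ 3)) * E t) (at t within X)" for t X
  proof -
    have "((\<lambda>t. complex_of_real (lam * (t / q t))) has_vector_derivative
        complex_of_real (lam * (\<rho>\<^sup>2 / q t ^ 3))) (at t within X)"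
      by (intro has_vector_derivative_of_real
          has_real_derivative_iff_has_vector_derivative[THEN iffD1]
          DERIV_cmult has_field_derivative_at_within[OF dphi])
    then have "((\<lambda>t. - (\<i> * complex_of_real (lam * (t / q t)))) has_vector_derivative
        - (\<i> * complex_of_real (lam * (\<rho>\<^sup>2 / q t ^ 3)))) (at t within X)"
      by (intro has_vector_derivative_minus has_vector_derivative_mult_right)
    from field_vector_diff_chain_within[OF this, of exp "exp (- (\<i> * complex_of_real (lam * (t / q t))))"]
    show ?thesis
      unfolding E_def o_def by (auto intro: DERIV_exp has_field_derivative_at_within)
  qed
  define G where "G t = \<i> * (complex_of_real (h t) * E t)" for t
  define R where "R t = \<i> * (complex_of_real (3 * t * q t / (lam * \<rho>\<^sup>2)) * E t)" for t
  have dG: "(G has_vector_derivative E t + R t) (at t within {l..r})" for t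
  proof -
    have "((\<lambda>t. complex_of_real (h t)) has_vector_derivative
        complex_of_real (3 * t * q t / (lam * \<rho>\<^sup>2))) (at t within {l..r})"
      by (intro has_vector_derivative_of_real
          has_real_derivative_iff_has_vector_derivative[THEN iffD1]
          has_field_derivative_at_within[OF dh])
    from has_vector_derivative_mult[OF this dE]
    have "(G has_vector_derivative \<i> * (complex_of_real (h t) *
        (- \<i> * complex_of_real (lam * (\<rho>\<^sup>2 / q t ^ 3)) * E t)
        + complex_of_real (3 * t * q t / (lam * \<rho>\<^sup>2)) * E t)) (at t within {l..r})"
      unfolding G_def by (intro has_vector_derivative_mult_right)
    moreover have "h t * (lam * (\<rho>\<^sup>2 / q t ^ 3)) = 1"
      using q_pos[of t] \<open>lam > 0\<close> \<open>\<rho> > 0\<close> by (simp add: h_def)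
    then have "complex_of_real (h t) * complex_of_real (lam * (\<rho>\<^sup>2 / q t ^ 3)) = 1"
      by (metis of_real_1 of_real_mult)
    then have "\<i> * (complex_of_real (h t) *
        (- \<i> * complex_of_real (lam * (\<rho>\<^sup>2 / q t ^ 3)) * E t)
        + complex_of_real (3 * t * q t / (lam * \<rho>\<^sup>2)) * E t) = E t + R t"
      unfolding R_def by (simp add: algebra_simps del: of_real_mult of_real_divide)
    ultimately show ?thesis by simp
  qed
  have iER: "((\<lambda>t. E t + R t) has_integral (G r - G l)) {l..r}"
    by (rule fundamental_theorem_of_calculus[OF \<open>l \<le> r\<close> dG])
  have contE: "continuous_on {l..r} E"
    unfolding continuous_on_eq_continuous_within
    using dE has_vector_derivative_continuous by blast
  have contq: "continuous_on {l..r} q"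
    unfolding q_def by (intro continuous_intros)
  have contR: "continuous_on {l..r} R"
    unfolding R_def using \<open>lam > 0\<close> \<open>\<rho> > 0\<close> by (intro continuous_intros contE contq) auto
  have "integral {l..r} E = integral {l..r} (\<lambda>t. E t + R t) - integral {l..r} R"
    using integral_add[of E "{l..r}" R] contE contR by (simp add: integrable_continuous_interval)
  also have "\<dots> = G r - G l - integral {l..r} R"
    using iER by (simp add: integral_unique)
  finally have eq: "integral {l..r} E = G r - G l - integral {l..r} R" .
  have nG: "norm (G t) \<le> 1 / (lam * \<rho>\<^sup>2)" if "t \<in> {l..r}" for t
  proof -
    have "q t ^ 3 \<le> 1" using q_le[OF that] q_pos[of t] by (simp add: power_le_one)
    then show ?thesis using \<open>lam > 0\<close> \<open>\<rho> > 0\<close> q_pos[of t]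
      by (simp add: G_def norm_mult nE h_def divide_right_mono del: of_real_mult of_real_divide of_real_power)
  qed
  have "norm (integral {l..r} R) \<le> 3 / (lam * \<rho>\<^sup>2) * (r - l)"
  proof (rule integral_bound[OF \<open>l \<le> r\<close> contR])
    fix t assume t: "t \<in> {l..r}"
    have "\<bar>t\<bar> * q t \<le> 1" using q_le[OF t] t_le[OF t] q_pos[of t]
      by (simp add: mult_le_one)
    then show "norm (R t) \<le> 3 / (lam * \<rho>\<^sup>2)"
      using \<open>lam > 0\<close> \<open>\<rho> > 0\<close> q_pos[of t]
      by (simp add: R_def norm_mult nE abs_mult divide_right_mono del: of_real_mult of_real_divide)
  qed
  also have "\<dots> \<le> 3 / (lam * \<rho>\<^sup>2) * 2"
    using t_le[of l] t_le[of r] \<open>l \<le> r\<close> \<open>lam > 0\<close> \<open>\<rho> > 0\<close> by (intro mult_left_mono) auto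
  finally have nR: "norm (integral {l..r} R) \<le> 6 / (lam * \<rho>\<^sup>2)" by simp
  have "norm (integral {l..r} E) \<le> norm (G r) + norm (G l) + norm (integral {l..r} R)"
    unfolding eq by (smt (verit) norm_triangle_ineq4)
  also have "\<dots> \<le> 1 / (lam * \<rho>\<^sup>2) + 1 / (lam * \<rho>\<^sup>2) + 6 / (lam * \<rho>\<^sup>2)"
    using nG[of r] nG[of l] nR \<open>l \<le> r\<close> by (intro add_mono) auto
  also have "\<dots> = 8 / (lam * \<rho>\<^sup>2)" by (simp add: field_simps)
  finally show ?thesis by (simp only: E_def[abs_def] q_def)
qed

text \<open>
  Up to the factor \<open>DIM('a)\<close>, the Fourier transform of the surface measure: that measure is the
  image of Lebesgue measure on the punctured unit ball under \<open>sgn\<close>.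
\<close>
definition cone_kernel :: "'a::euclidean_space \<Rightarrow> complex" where
  "cone_kernel x = (LINT u:cball 0 1 - {0}|lborel. exp (- (\<i> * complex_of_real (x \<bullet> sgn u))))"

text \<open>
  Average along \<open>w\<close>: a line in direction \<open>w\<close> meets the slab in a segment of length at most \<open>2 * \<delta>\<close>.
\<close>
lemma emeasure_slab_le:
  fixes w :: "'a::euclidean_space"
  assumes "norm w = 1" "R \<ge> 0" "\<delta> > 0"
  shows "emeasure lborel {y \<in> cball 0 R. \<bar>y \<bullet> w\<bar> < \<delta>} \<le> ennreal (2 * \<delta>) * emeasure lborel (cball (0::'a) (R + 1))"
proof -
  define A where "A = {y \<in> cball 0 R. \<bar>y \<bullet> w\<bar> < \<delta>}"
  have "A = cball 0 R \<inter> {y. \<bar>y \<bullet> w\<bar> < \<delta>}" by (auto simp: A_def)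
  then have [measurable]: "A \<in> sets borel"
    by (auto intro!: sets.Int borel_open open_Collect_less continuous_intros)
  have "emeasure lborel A = emeasure lborel {0..1::real} * (\<integral>\<^sup>+y. indicator A y \<partial>lborel)"
    by simp
  also have "\<dots> = (\<integral>\<^sup>+y. (\<integral>\<^sup>+(t::real). indicator {0..1} t * indicator A (t *\<^sub>R w + y) \<partial>lborel) \<partial>lborel)"
    by (rule nn_integral_line_average) auto
  also have "\<dots> \<le> (\<integral>\<^sup>+y. ennreal (2 * \<delta>) * indicator (cball (0::'a) (R + 1)) y \<partial>lborel)"
  proof (rule nn_integral_mono)
    fix y :: 'a
    have "(\<integral>\<^sup>+(t::real). indicator {0..1} t * indicator A (t *\<^sub>R w + y) \<partial>lborel)
        \<le> (\<integral>\<^sup>+t. indicator (cball 0 (R + 1)) y * indicator {- (y \<bullet> w) - \<delta> .. - (y \<bullet> w) + \<delta>} t \<partial>lborel)"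
    proof (rule nn_integral_mono)
      fix t :: real
      show "indicator {0..1} t * indicator A (t *\<^sub>R w + y)
          \<le> (indicator (cball 0 (R + 1)) y * indicator {- (y \<bullet> w) - \<delta> .. - (y \<bullet> w) + \<delta>} t :: ennreal)"
      proof (cases "t \<in> {0..1} \<and> t *\<^sub>R w + y \<in> A")
        case True
        have "norm y \<le> norm (t *\<^sub>R w + y) + norm (t *\<^sub>R w)"
          using norm_triangle_ineq4[of "t *\<^sub>R w + y" "t *\<^sub>R w"] by simp
        also have "\<dots> \<le> R + 1" using True assms by (auto simp: A_def)
        finally have "norm y \<le> R + 1" .
        moreover have "w \<bullet> w = 1" using assms by (simp add: dot_square_norm)
        then have "\<bar>t + y \<bullet> w\<bar> < \<delta>" using True by (simp add: A_def inner_add_left)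
        ultimately show ?thesis by (auto simp: indicator_def)
      qed (auto simp: indicator_def)
    qed
    also have "\<dots> = ennreal (2 * \<delta>) * indicator (cball 0 (R + 1)) y"
      using \<open>\<delta> > 0\<close> by (simp add: nn_integral_cmult mult.commute)
    finally show "(\<integral>\<^sup>+(t::real). indicator {0..1} t * indicator A (t *\<^sub>R w + y) \<partial>lborel)
        \<le> ennreal (2 * \<delta>) * indicator (cball 0 (R + 1)) y" .
  qed
  also have "\<dots> = ennreal (2 * \<delta>) * emeasure lborel (cball (0::'a) (R + 1))"
    by (rule nn_integral_cmult_indicator) auto
  finally show ?thesis by (simp add: A_def)
qed

text \<open>
  The oscillatory bound for an arbitrary line in direction \<open>e\<close>. The line meets the unit ball in
  a segment, and after a shift of the parameter the integrand is the one of
  \<open>oscillatory_integral_bound\<close>, \<open>\<rho>\<close> being the distance of the line from the origin.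
\<close>
lemma line_oscillatory_bound:
  fixes e y :: "'a::euclidean_space"
  assumes e: "norm e = 1" and lam: "lam > 0" and "s > 0" and s: "s \<le> norm (y - (y \<bullet> e) *\<^sub>R e)"
  shows "norm (LINT t:{-2..2}|lborel. indicator (cball 0 1 - {0}) (t *\<^sub>R e + y) *\<^sub>R
            exp (- (\<i> * complex_of_real (lam * (e \<bullet> sgn (t *\<^sub>R e + y)))))) \<le> 8 / (lam * s\<^sup>2)"
    (is "norm ?I \<le> _")
proof -
  define \<alpha> where "\<alpha> = y \<bullet> e"
  define v where "v = y - \<alpha> *\<^sub>R e"
  define \<rho> where "\<rho> = norm v"
  have \<rho>: "\<rho> \<ge> s" "\<rho> > 0" using s \<open>s > 0\<close> by (auto simp: \<rho>_def v_def \<alpha>_def)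
  have ee: "e \<bullet> e = 1" using e by (simp add: dot_square_norm)
  have ev: "e \<bullet> v = 0" by (simp add: v_def \<alpha>_def inner_diff_right ee inner_commute)
  have line: "t *\<^sub>R e + y = (t + \<alpha>) *\<^sub>R e + v" for t by (simp add: v_def algebra_simps)
  have nrm2: "(norm (t *\<^sub>R e + y))\<^sup>2 = (t + \<alpha>)\<^sup>2 + \<rho>\<^sup>2" for t
    using norm_add_Pythagorean[of "(t + \<alpha>) *\<^sub>R e" v] e ev
    by (simp add: line \<rho>_def orthogonal_def)
  then have nrm: "norm (t *\<^sub>R e + y) = sqrt ((t + \<alpha>)\<^sup>2 + \<rho>\<^sup>2)" for t
    by (metis norm_ge_zero real_sqrt_unique)
  have nz: "t *\<^sub>R e + y \<noteq> 0" for t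
    using nrm2[of t] \<rho>(2) by (metis add_nonneg_pos less_irrefl norm_zero power_zero_numeral zero_le_power2 zero_less_power)
  have sg: "e \<bullet> sgn (t *\<^sub>R e + y) = (\<alpha> + t) / sqrt ((\<alpha> + t)\<^sup>2 + \<rho>\<^sup>2)" for t
    unfolding sgn_div_norm nrm by (simp add: inner_add_right ee \<alpha>_def inner_commute[of e y] add.commute divide_inverse mult.commute)
  define g where "g t = exp (- (\<i> * complex_of_real (lam * (t / sqrt (t\<^sup>2 + \<rho>\<^sup>2)))))" for t
  define m where "m = sqrt (1 - \<rho>\<^sup>2)"
  define l where "l = max (-2) (- \<alpha> - m)"
  define r where "r = min 2 (m - \<alpha>)"
  have in_ball: "norm (t *\<^sub>R e + y) \<le> 1 \<longleftrightarrow> (t + \<alpha>)\<^sup>2 + \<rho>\<^sup>2 \<le> 1" for t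
    using nrm by simp
  have pos: "0 \<le> 8 / (lam * s\<^sup>2)" using lam by simp
  show ?thesis
  proof (cases "\<rho> \<le> 1 \<and> l \<le> r")
    case False
    have "\<not> (t \<in> {-2..2} \<and> norm (t *\<^sub>R e + y) \<le> 1)" for t
    proof
      assume t: "t \<in> {-2..2} \<and> norm (t *\<^sub>R e + y) \<le> 1"
      then have "(t + \<alpha>)\<^sup>2 + \<rho>\<^sup>2 \<le> 1" by (simp add: in_ball)
      then have "\<rho>\<^sup>2 \<le> 1" "(t + \<alpha>)\<^sup>2 \<le> 1 - \<rho>\<^sup>2" by (smt (verit) zero_le_power2)+
      then have "\<bar>t + \<alpha>\<bar> \<le> m" unfolding m_def by (simp add: real_le_rsqrt abs_le_square_iff)
      then have "l \<le> t" "t \<le> r" using t by (auto simp: l_def r_def)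
      moreover have "\<rho> \<le> 1" using \<open>\<rho>\<^sup>2 \<le> 1\<close> \<rho>(2) by (simp add: power_le_one_iff)
      ultimately show False using False by linarith
    qed
    then have "?I = (LINT t:{-2..2::real}|lborel. 0)"
      unfolding set_lebesgue_integral_def by (intro Bochner_Integration.integral_cong) (auto simp: indicator_def)
    then show ?thesis using pos by (simp add: set_lebesgue_integral_def)
  next
    case True
    have m2: "m\<^sup>2 = 1 - \<rho>\<^sup>2" "m \<ge> 0" using True \<rho>(2) by (auto simp: m_def power_le_one)
    have lr: "t \<in> {l..r} \<longleftrightarrow> t \<in> {-2..2} \<and> norm (t *\<^sub>R e + y) \<le> 1" for t
    proof -
      have "(t + \<alpha>)\<^sup>2 \<le> m\<^sup>2 \<longleftrightarrow> \<bar>t + \<alpha>\<bar> \<le> m"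
        using m2(2) by (metis abs_le_square_iff abs_of_nonneg)
      then show ?thesis unfolding in_ball l_def r_def using m2 by auto
    qed
    have "?I = (LINT t:{l..r}|lborel. (g \<circ> (+) \<alpha>) t)"
      unfolding set_lebesgue_integral_def
    proof (intro Bochner_Integration.integral_cong refl)
      fix t
      show "indicat_real {-2..2} t *\<^sub>R indicat_real (cball 0 1 - {0}) (t *\<^sub>R e + y) *\<^sub>R
          exp (- (\<i> * complex_of_real (lam * (e \<bullet> sgn (t *\<^sub>R e + y)))))
        = indicat_real {l..r} t *\<^sub>R (g \<circ> (+) \<alpha>) t"
        using lr[of t] nz[of t] unfolding g_def sg o_def by (auto simp: indicator_def)
    qed
    also have "\<dots> = integral {l..r} (g \<circ> (+) \<alpha>)"
    proof (rule set_borel_integral_eq_integral(2), rule borel_integrable_atLeastAtMost')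
      have "(\<alpha> + t)\<^sup>2 + \<rho>\<^sup>2 \<noteq> 0" for t using \<rho>(2) by (simp add: sum_power2_eq_zero_iff)
      then show "continuous_on {l..r} (g \<circ> (+) \<alpha>)"
        unfolding g_def o_def by (intro continuous_intros) auto
    qed
    also have "\<dots> = integral {l + \<alpha>..r + \<alpha>} g" by (rule integral_shift_Icc_real)
    finally have "norm ?I = norm (integral {l + \<alpha>..r + \<alpha>} g)" by simp
    also have "\<dots> \<le> 8 / (lam * \<rho>\<^sup>2)"
      unfolding g_def
    proof (rule oscillatory_integral_bound[OF lam \<rho>(2)])
      show "l + \<alpha> \<le> r + \<alpha>" using True by simp
      fix t assume "t \<in> {l + \<alpha>..r + \<alpha>}"
      then have "t - \<alpha> \<in> {l..r}" by auto
      then show "t\<^sup>2 + \<rho>\<^sup>2 \<le> 1" using lr[of "t - \<alpha>"] in_ball[of "t - \<alpha>"] by simp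
    qed
    also have "\<dots> \<le> 8 / (lam * s\<^sup>2)"
      using lam \<rho> \<open>s > 0\<close> by (intro divide_left_mono mult_left_mono mult_pos_pos power_mono) auto
    finally show ?thesis .
  qed
qed

text \<open>
  Average along the direction \<open>e\<close> of \<open>x\<close>. Lines that keep a distance \<open>\<delta>\<close> from the origin contribute
  \<open>O(1 / (norm x * \<delta>\<^sup>2))\<close> each by oscillation. To control the others, choose a unit vector \<open>w\<close>
  orthogonal to \<open>e\<close>, which is where the dimension has to be at least two: they lie in a slab of
  width \<open>2 * \<delta>\<close> orthogonal to \<open>w\<close>, hence fill a set of measure \<open>O(\<delta>)\<close>. The choice
  \<open>\<delta> = norm x powr (-1/3)\<close> balances the two. The optimal rate \<open>(DIM('a) - 1) / 2\<close> is not sought: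
  any positive power of decay gives a restriction estimate for some exponent above 1.
\<close>
lemma cone_kernel_decay:
  fixes x :: "'a::euclidean_space"
  assumes dim: "2 \<le> DIM('a)" and "x \<noteq> 0"
  shows "norm (cone_kernel x) \<le> 4 * measure lborel (cball (0::'a) 4) * norm x powr (- (1/3))"
proof -
  define lam where "lam = norm x"
  define e where "e = sgn x"
  define V where "V = measure lborel (cball (0::'a) 4)"
  have lam: "lam > 0" and e: "norm e = 1" and x: "x = lam *\<^sub>R e"
    using \<open>x \<noteq> 0\<close> by (auto simp: lam_def e_def norm_sgn sgn_div_norm)
  obtain w0 where w0: "w0 \<noteq> 0" "orthogonal e w0"
    using orthogonal_to_vector_exists[OF dim] by blast
  define w where "w = sgn w0"
  have w: "norm w = 1" and ew: "e \<bullet> w = 0"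
    using w0 by (auto simp: w_def norm_sgn sgn_div_norm orthogonal_def)
  define \<delta> where "\<delta> = lam powr (- (1/3))"
  have \<delta>: "\<delta> > 0" using lam by (simp add: \<delta>_def)
  have d3: "1 / (lam * \<delta>\<^sup>2) = \<delta>"
  proof -
    have "\<delta>\<^sup>2 = lam powr (- (2/3))"
      unfolding \<delta>_def by (simp flip: powr_numeral add: powr_powr)
    then have "lam * \<delta>\<^sup>2 = lam powr (1/3)"
      using lam by (simp add: powr_mult_base)
    then show ?thesis by (simp add: \<delta>_def powr_minus_divide)
  qed
  define F :: "'a \<Rightarrow> complex" where "F u = indicator (cball 0 1 - {0}) u *\<^sub>R exp (- (\<i> * complex_of_real (lam * (e \<bullet> sgn u))))" for u
  have kF: "cone_kernel x = (LINT u|lborel. F u)"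
    unfolding cone_kernel_def set_lebesgue_integral_def F_def x by simp
  have [measurable]: "cball (0::'a) 1 - {0} \<in> sets borel"
    by auto
  have [measurable]: "F \<in> borel_measurable borel"
    unfolding F_def by measurable
  have nF: "norm (F u) \<le> indicator (cball 0 1) u" for u
    by (auto simp: F_def indicator_def)
  have iF: "integrable lborel F"
  proof (rule Bochner_Integration.integrable_bound[of _ "indicator (cball 0 1) :: 'a \<Rightarrow> real"])
    show "integrable lborel (indicator (cball 0 1) :: 'a \<Rightarrow> real)"
      using emeasure_lborel_cball_finite[of "0::'a" 1] by (simp add: integrable_indicator_iff)
  qed (use nF in auto)
  \<comment> \<open>The segments have length 4, so \<open>I y\<close> vanishes unless \<open>norm y \<le> 3\<close>.\<close>
  define I where "I y = (LINT t:{-2..2}|lborel. F (t *\<^sub>R e + y))" for y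
  have avg: "4 *\<^sub>R cone_kernel x = (LINT y|lborel. I y)"
    using integral_line_average[OF iF, of "-2" 2 e] by (simp add: kF I_def)
  define S where "S = {y \<in> cball (0::'a) 3. \<bar>y \<bullet> w\<bar> < \<delta>}"
  have "S = cball 0 3 \<inter> {y. \<bar>y \<bullet> w\<bar> < \<delta>}" by (auto simp: S_def)
  then have [measurable]: "S \<in> sets borel"
    by (auto intro!: sets.Int borel_open open_Collect_less continuous_intros)
  have bound: "ennreal (norm (I y)) \<le> ennreal (8 * \<delta>) * indicator (cball 0 4) y + 4 * indicator S y" for y
  proof (cases "y \<in> cball 0 3")
    case False
    have "norm y \<le> norm (t *\<^sub>R e + y) + norm (t *\<^sub>R e)" for t
      using norm_triangle_ineq4[of "t *\<^sub>R e + y" "t *\<^sub>R e"] by simp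
    from this have "norm y \<le> norm (t *\<^sub>R e + y) + \<bar>t\<bar>" for t
      using e by simp
    moreover have "norm y > 3"
      using False by simp
    ultimately have "\<not> (t \<in> {-2..2} \<and> norm (t *\<^sub>R e + y) \<le> 1)" for t
      by (smt (verit) atLeastAtMost_iff)
    then have "I y = (LINT t:{-2..2::real}|lborel. 0)"
      unfolding I_def F_def set_lebesgue_integral_def by (intro Bochner_Integration.integral_cong) (auto simp: indicator_def)
    then show ?thesis by (simp add: set_lebesgue_integral_def)
  next
    case y3: True
    show ?thesis
    proof (cases "y \<in> S")
      case True
      have "norm (I y) \<le> (LINT t|lborel. norm (indicator {-2..2} t *\<^sub>R F (t *\<^sub>R e + y)))"
        unfolding I_def set_lebesgue_integral_def by (rule integral_norm_bound)
      also have "\<dots> \<le> (LINT t|lborel. indicator {-2..2::real} t)"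
      proof (rule integral_mono')
        show "integrable lborel (indicat_real {-2..2::real})"
          by (simp add: integrable_indicator_iff emeasure_lborel_Icc_eq)
        show "norm (indicat_real {-2..2} t *\<^sub>R F (t *\<^sub>R e + y)) \<le> indicat_real {-2..2} t" for t
          by (auto simp: F_def indicator_def)
      qed auto
      also have "\<dots> = 4" by simp
      finally have "ennreal (norm (I y)) \<le> 4" by (metis ennreal_leI ennreal_numeral zero_le_numeral)
      then show ?thesis using True by (simp add: add_increasing)
    next
      case False
      then have yw: "\<delta> \<le> \<bar>y \<bullet> w\<bar>" using y3 by (auto simp: S_def)
      also have "\<bar>y \<bullet> w\<bar> = \<bar>(y - (y \<bullet> e) *\<^sub>R e) \<bullet> w\<bar>" by (simp add: inner_diff_left ew)
      also have "\<dots> \<le> norm (y - (y \<bullet> e) *\<^sub>R e)" using Cauchy_Schwarz_ineq2[of _ w] w by simp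
      finally have "norm (I y) \<le> 8 / (lam * \<delta>\<^sup>2)"
        unfolding I_def F_def by (rule line_oscillatory_bound[OF e lam \<delta>])
      also have "\<dots> = 8 * \<delta>" using d3 by (simp add: field_simps)
      finally have "ennreal (norm (I y)) \<le> ennreal (8 * \<delta>)" by (rule ennreal_leI)
      moreover have "y \<in> cball 0 4" using y3 by auto
      ultimately show ?thesis by (simp add: add_increasing2)
    qed
  qed
  have [measurable]: "cball (0::'a) 4 \<in> sets borel" by auto
  have V_nonneg: "0 \<le> V" by (simp add: V_def)
  have Vfin: "emeasure lborel (cball (0::'a) 4) = ennreal V"
    unfolding V_def by (rule emeasure_eq_ennreal_measure) (use emeasure_lborel_cball_finite[of "0::'a" 4] in auto)
  have "ennreal (norm (LINT y|lborel. I y)) \<le> (\<integral>\<^sup>+y. ennreal (norm (I y)) \<partial>lborel)"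
    using integral_norm_bound_ennreal[of lborel I]
    by (cases "integrable lborel I") (simp_all add: not_integrable_integral_eq)
  also have "\<dots> \<le> (\<integral>\<^sup>+y. ennreal (8 * \<delta>) * indicator (cball 0 4) y + 4 * indicator S y \<partial>lborel)"
    by (rule nn_integral_mono) (rule bound)
  also have "\<dots> = ennreal (8 * \<delta>) * ennreal V + 4 * emeasure lborel S"
    by (subst nn_integral_add) (measurable, simp add: nn_integral_cmult_indicator Vfin)
  also have "\<dots> \<le> ennreal (8 * \<delta>) * ennreal V + 4 * (ennreal (2 * \<delta>) * ennreal V)"
    using emeasure_slab_le[OF w, of 3 \<delta>] \<delta> unfolding S_def Vfin[symmetric]
    by (intro add_left_mono mult_left_mono) auto
  also have "\<dots> = ennreal (16 * \<delta> * V)"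
  proof -
    have "4 * (ennreal (2 * \<delta>) * ennreal V) = ennreal (4 * (2 * \<delta> * V))"
      using \<delta> V_nonneg by (subst ennreal_mult; simp)+
    moreover have "ennreal (8 * \<delta>) * ennreal V = ennreal (8 * \<delta> * V)"
      using \<delta> V_nonneg by (intro ennreal_mult[symmetric]) auto
    ultimately have "ennreal (8 * \<delta>) * ennreal V + 4 * (ennreal (2 * \<delta>) * ennreal V)
        = ennreal (8 * \<delta> * V + 4 * (2 * \<delta> * V))"
      using \<delta> V_nonneg by (subst ennreal_plus) auto
    then show ?thesis by (simp add: mult_ac)
  qed
  finally have "norm (LINT y|lborel. I y) \<le> 16 * \<delta> * V"
    using \<delta> by (subst (asm) ennreal_le_iff) (auto simp: V_def)
  then have "4 * norm (cone_kernel x) \<le> 16 * \<delta> * V"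
    unfolding avg[symmetric] by simp
  then show ?thesis by (simp add: V_def \<delta>_def lam_def mult_ac)
qed

section \<open>Integrability of powers of the kernel\<close>

lemma emeasure_ball_conv_unit_ball:
  assumes "R \<ge> 0"
  shows "emeasure lborel (ball (0::'a::euclidean_space) R) = ennreal (R ^ DIM('a) * measure lborel (ball (0::'a) 1))"
proof -
  have "emeasure lborel (ball (0::'a) R) = ennreal (measure lborel (ball (0::'a) R))"
    by (rule emeasure_eq_ennreal_measure) (use emeasure_lborel_ball_finite[of "0::'a" R] in auto)
  then show ?thesis using content_ball_conv_unit_ball[OF assms, of "0::'a"] by simp
qed

text \<open>
  Compare \<open>h\<close> with a step function that is constant on the shells \<open>n \<le> norm x < n + 1\<close>. Enlarging
  each shell to the ball of radius \<open>n + 1\<close> costs \<open>O(n ^ DIM('a))\<close>, and two extra powers of decay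
  leave the convergent series of the inverse squares.
\<close>
lemma nn_integral_finite_if_decay:
  fixes h :: "'a::euclidean_space \<Rightarrow> real"
  assumes bdd: "\<And>x. h x \<le> M" and decay: "\<And>x. 1 \<le> norm x \<Longrightarrow> h x \<le> M / norm x ^ (DIM('a) + 2)"
    and "M \<ge> 0"
  shows "(\<integral>\<^sup>+x. ennreal (h x) \<partial>lborel) < \<infinity>"
proof -
  define s where "s = DIM('a) + 2"
  define c where "c n = M * 2 ^ s / real (Suc n) ^ s" for n
  have c_nonneg: "c n \<ge> 0" for n using \<open>M \<ge> 0\<close> by (simp add: c_def)
  define v where "v = measure lborel (ball (0::'a) 1)"
  have pointwise: "ennreal (h x) \<le> (\<Sum>n. ennreal (c n) * indicator (ball 0 (real (Suc n))) x)" for x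
  proof -
    define n where "n = nat \<lfloor>norm x\<rfloor>"
    have n: "real n \<le> norm x" "norm x < real (Suc n)"
      unfolding n_def by (simp_all add: of_nat_nat) linarith
    have "h x \<le> c n"
    proof (cases "1 \<le> norm x")
      case True
      then have "real (Suc n) / 2 \<le> norm x" using n by (cases n) auto
      then have "M / norm x ^ s \<le> M / (real (Suc n) / 2) ^ s"
        using \<open>M \<ge> 0\<close> True by (intro divide_left_mono power_mono mult_pos_pos zero_less_power) auto
      also have "\<dots> = c n" by (simp add: c_def power_divide)
      finally show ?thesis using decay[OF True] by (simp add: s_def)
    next
      case False
      then have "n = 0" using n by linarith
      have "M * 1 \<le> M * 2 ^ s" using \<open>M \<ge> 0\<close> by (intro mult_left_mono) auto
      then show ?thesis using bdd[of x] \<open>n = 0\<close> by (simp add: c_def)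
    qed
    then have "ennreal (h x) \<le> ennreal (c n)" by (rule ennreal_leI)
    also have "\<dots> = (\<Sum>n\<in>{n}. ennreal (c n) * indicator (ball 0 (real (Suc n))) x)"
      using n by simp
    also have "\<dots> \<le> (\<Sum>n. ennreal (c n) * indicator (ball 0 (real (Suc n))) x)"
      by (rule sum_le_suminf) (auto intro: summableI)
    finally show ?thesis .
  qed
  have [measurable]: "ball (0::'a) R \<in> sets borel" for R by auto
  have summ: "summable (\<lambda>n. M * 2 ^ s * v * inverse (real (Suc n) ^ 2))"
    by (intro summable_mult) (use inverse_power_summable[of 2, where 'a=real] in \<open>subst summable_Suc_iff\<close>, simp)
  have "(\<integral>\<^sup>+x. ennreal (h x) \<partial>lborel) \<le> (\<integral>\<^sup>+x. (\<Sum>n. ennreal (c n) * indicator (ball (0::'a) (real (Suc n))) x) \<partial>lborel)"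
    by (rule nn_integral_mono) (rule pointwise)
  also have "\<dots> = (\<Sum>n. ennreal (c n) * emeasure lborel (ball (0::'a) (real (Suc n))))"
    by (subst nn_integral_suminf) (measurable, simp add: nn_integral_cmult_indicator del: of_nat_Suc)
  also have "\<dots> = (\<Sum>n. ennreal (M * 2 ^ s * v * inverse (real (Suc n) ^ 2)))"
  proof (rule suminf_cong)
    fix n
    have "ennreal (c n) * emeasure lborel (ball (0::'a) (real (Suc n))) = ennreal (c n * (real (Suc n) ^ DIM('a) * v))"
      using c_nonneg by (subst emeasure_ball_conv_unit_ball) (auto simp: v_def ennreal_mult)
    also have "c n * (real (Suc n) ^ DIM('a) * v) = M * 2 ^ s * v * inverse (real (Suc n) ^ 2)"
      by (simp add: c_def s_def field_simps power_add power2_eq_square del: of_nat_Suc)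
    finally show "ennreal (c n) * emeasure lborel (ball (0::'a) (real (Suc n)))
      = ennreal (M * 2 ^ s * v * inverse (real (Suc n) ^ 2))" .
  qed
  also have "\<dots> = ennreal (\<Sum>n. M * 2 ^ s * v * inverse (real (Suc n) ^ 2))"
    using \<open>M \<ge> 0\<close> by (intro suminf_ennreal2 summ) (simp add: v_def)
  also have "\<dots> < \<infinity>" by simp
  finally show ?thesis .
qed

lemma norm_cone_kernel_le:
  fixes x :: "'a::euclidean_space"
  shows "norm (cone_kernel x) \<le> measure lborel (cball (0::'a) 1)"
proof -
  have [measurable]: "cball (0::'a) 1 \<in> sets borel" by auto
  have "norm (cone_kernel x) \<le> (LINT u|lborel. norm (indicator (cball 0 1 - {0}) u *\<^sub>R exp (- (\<i> * complex_of_real (x \<bullet> sgn u)))))"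
    unfolding cone_kernel_def set_lebesgue_integral_def by (rule integral_norm_bound)
  also have "\<dots> \<le> (LINT u|lborel. indicator (cball (0::'a) 1) u)"
  proof (rule integral_mono')
    show "integrable lborel (indicat_real (cball (0::'a) 1))"
      using emeasure_lborel_cball_finite[of "0::'a" 1] by (simp add: integrable_indicator_iff)
  qed (auto simp: indicator_def)
  finally show ?thesis by simp
qed

lemma cone_kernel_minus: "cone_kernel (- x) = cnj (cone_kernel x)"
proof -
  have "cone_kernel (- x) = (LINT u|lborel. cnj (indicator (cball 0 1 - {0}) u *\<^sub>R exp (- (\<i> * complex_of_real (x \<bullet> sgn u)))))"
    unfolding cone_kernel_def set_lebesgue_integral_def
    by (rule Bochner_Integration.integral_cong) (simp_all add: exp_cnj)
  also have "\<dots> = cnj (cone_kernel x)"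
    unfolding cone_kernel_def set_lebesgue_integral_def by (rule Bochner_Integration.integral_cnj)
  finally show ?thesis .
qed

lemma cone_kernel_measurable [measurable]: "cone_kernel \<in> borel_measurable borel"
proof -
  have [measurable]: "cball (0::'a) 1 - {0} \<in> sets borel" by auto
  show ?thesis
    unfolding cone_kernel_def set_lebesgue_integral_def
    by (rule sigma_finite_measure.borel_measurable_lebesgue_integral[OF sigma_finite_lborel]) measurable
qed

text \<open>
  The power is chosen so that the decay rate \<open>1/3\<close> becomes \<open>DIM('a) + 2\<close>.
\<close>
lemma cone_kernel_power_integrable:
  assumes dim: "2 \<le> DIM('a::euclidean_space)"
  shows "(\<integral>\<^sup>+x. ennreal (norm (cone_kernel (x::'a)) ^ (3 * (DIM('a) + 2))) \<partial>lborel) < \<infinity>"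
proof -
  define C where "C = 4 * measure lborel (cball (0::'a) 4)"
  define B where "B = measure lborel (cball (0::'a) 1)"
  define r where "r = 3 * (DIM('a) + 2)"
  have nn: "C \<ge> 0" "B \<ge> 0" by (simp_all add: C_def B_def)
  show ?thesis
    unfolding r_def[symmetric]
  proof (rule nn_integral_finite_if_decay[where M = "max C B ^ r"])
    fix x :: 'a
    show "norm (cone_kernel x) ^ r \<le> max C B ^ r"
      using norm_cone_kernel_le[of x] by (intro power_mono) (auto simp: B_def)
    assume x: "1 \<le> norm x"
    have "norm (cone_kernel x) ^ r \<le> (max C B * norm x powr (- (1/3))) ^ r"
    proof (intro power_mono)
      have "norm (cone_kernel x) \<le> C * norm x powr (- (1/3))"
        unfolding C_def by (rule cone_kernel_decay[OF dim]) (use x in auto)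
      also have "\<dots> \<le> max C B * norm x powr (- (1/3))" by (intro mult_right_mono) auto
      finally show "norm (cone_kernel x) \<le> max C B * norm x powr (- (1/3))" .
    qed auto
    also have "\<dots> = max C B ^ r * (norm x powr (- (1/3))) ^ r" by (rule power_mult_distrib)
    also have "(norm x powr (- (1/3))) ^ r = norm x powr (- real (DIM('a) + 2))"
    proof -
      have "(norm x powr (- (1/3))) ^ r = norm x powr (- (1/3) * real r)"
        using x by (subst powr_realpow[symmetric]) (auto simp only: powr_powr powr_gt_zero)
      also have "- (1/3) * real r = - real (DIM('a) + 2)" by (simp add: r_def field_simps)
      finally show ?thesis .
    qed
    also have "\<dots> = 1 / norm x ^ (DIM('a) + 2)"
    proof -
      have "norm x > 0" using x by linarith
      then show ?thesis by (simp only: powr_minus_divide powr_realpow)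
    qed
    finally show "norm (cone_kernel x) ^ r \<le> max C B ^ r / norm x ^ (DIM('a) + 2)" by simp
  next
    show "0 \<le> max C B ^ r" using nn by simp
  qed
qed

section \<open>A restriction estimate\<close>

lemma integrable_pair_mult:
  fixes f g :: "'a::euclidean_space \<Rightarrow> complex"
  assumes f: "integrable lborel f" and g: "integrable lborel g"
  shows "integrable (lborel \<Otimes>\<^sub>M lborel) (\<lambda>(x, y). f x * g y)"
proof (rule lborel_pair.Fubini_integrable)
  have [measurable]: "f \<in> borel_measurable borel" "g \<in> borel_measurable borel"
    using f g by auto
  show "(\<lambda>(x, y). f x * g y) \<in> borel_measurable (lborel \<Otimes>\<^sub>M lborel)" by measurable
qed (use f g in \<open>simp_all add: norm_mult\<close>)

text \<open>
  The \<open>T T*\<close> identity: writing \<open>|F|\<^sup>2 = F * cnj F\<close> as a double integral and integrating over the ball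
  first leaves the kernel at \<open>x - y\<close> between \<open>f x\<close> and \<open>cnj (f y)\<close>. Fubini applies because \<open>f\<close> is
  integrable and the ball has finite measure; only afterwards are absolute values taken.
\<close>
lemma fourier_square_integral_le:
  fixes f :: "'a::euclidean_space \<Rightarrow> complex"
  assumes f: "integrable lborel f"
  defines "F \<equiv> (\<lambda>k. LINT x|lborel. exp (- (\<i> * complex_of_real (k \<bullet> x))) * f x)"
  shows "(\<integral>\<^sup>+u. indicator (cball 0 1 - {0}) u * ennreal ((norm (F (sgn u)))\<^sup>2) \<partial>lborel)
    \<le> (\<integral>\<^sup>+x. (\<integral>\<^sup>+y. ennreal (norm (f x) * norm (f y) * norm (cone_kernel (x - y))) \<partial>lborel) \<partial>lborel)"
proof -
  define B where "B = cball (0::'a) 1 - {0}"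
  define N where "N = restrict_space lborel B"
  define P where "P = (lborel :: 'a measure) \<Otimes>\<^sub>M (lborel :: 'a measure)"
  have [measurable]: "f \<in> borel_measurable borel" using f by simp
  have B [measurable]: "B \<in> sets borel" by (simp add: B_def)
  have Bfin: "emeasure lborel B < \<infinity>"
    using emeasure_lborel_cball_finite[of "0::'a" 1] emeasure_mono[of B "cball 0 1" lborel]
    by (auto simp: B_def intro: le_less_trans)
  have sN: "emeasure N (space N) < \<infinity>"
    using Bfin by (simp add: N_def emeasure_restrict_space space_restrict_space)
  interpret N: finite_measure N
    by standard (use sN in auto)
  interpret P: sigma_finite_measure P
    unfolding P_def by (rule sigma_finite_pair_measure) (rule sigma_finite_lborel)+
  interpret NP: pair_sigma_finite N P ..
  have idN [measurable]: "(\<lambda>u. u) \<in> N \<rightarrow>\<^sub>M borel"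
    unfolding N_def by (rule measurable_restrict_space1) simp
  define E where "E x u = exp (- (\<i> * complex_of_real (sgn u \<bullet> x)))" for x u :: 'a
  have nE: "norm (E x u) = 1" for x u by (simp add: E_def)
  have E_meas [measurable]: "(\<lambda>(x, u). E x u) \<in> borel_measurable (borel \<Otimes>\<^sub>M borel)"
    unfolding E_def by measurable
  have iE: "integrable lborel (\<lambda>x. E x u * f x)" for u
    by (rule Bochner_Integration.integrable_bound[OF f]) (auto simp: norm_mult nE)
  have [measurable]: "cnj \<in> borel_measurable borel"
    by (intro borel_measurable_continuous_onI continuous_intros)
  define g where "g = (\<lambda>(u, (x, y)). (E x u * f x) * cnj (E y u * f y))"
  have g_meas: "g \<in> borel_measurable (N \<Otimes>\<^sub>M P)"
    unfolding g_def P_def by measurable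
  have ig: "integrable P (\<lambda>z. g (u, z))" for u
    using integrable_pair_mult[OF iE[of u], of "\<lambda>y. cnj (E y u * f y)"] iE[of u]
    by (simp add: P_def g_def case_prod_unfold integrable_cnj del: complex_cnj_mult)
  have gnorm: "norm (g (u, z)) = norm (f (fst z)) * norm (f (snd z))" for u z
    by (simp add: g_def case_prod_unfold norm_mult nE)
  have ig2: "integrable (N \<Otimes>\<^sub>M P) g"
    by (rule NP.Fubini_integrable[OF g_meas]) (use ig in \<open>simp_all add: gnorm\<close>)
  have "(LINT z|P. g (u, z)) = complex_of_real ((norm (F (sgn u)))\<^sup>2)" for u
  proof -
    have "(LINT z|P. g (u, z)) = (LINT x|lborel. (LINT y|lborel. (E x u * f x) * cnj (E y u * f y)))"
      using lborel_pair.integral_fst[of "\<lambda>x y. (E x u * f x) * cnj (E y u * f y)"] ig[of u]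
      by (simp add: P_def g_def case_prod_unfold)
    also have "\<dots> = (LINT x|lborel. E x u * f x) * cnj (LINT y|lborel. E y u * f y)"
      using iE[of u] by (simp only: integral_mult_right_zero integral_mult_left_zero Bochner_Integration.integral_cnj)
    also have "\<dots> = complex_of_real ((norm (F (sgn u)))\<^sup>2)"
      unfolding F_def E_def by (simp only: complex_norm_square)
    finally show ?thesis .
  qed
  then have "complex_of_real (LINT u|N. (norm (F (sgn u)))\<^sup>2) = (LINT u|N. (LINT z|P. g (u, z)))"
    by (simp only: integral_complex_of_real)
  also have "\<dots> = (LINT z|P. (LINT u|N. g (u, z)))"
    using NP.Fubini_integral[of "\<lambda>u z. g (u, z)"] ig2 by simp
  also have "\<dots> = (LINT z|P. f (fst z) * cnj (f (snd z)) * cone_kernel (fst z - snd z))"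
  proof (rule Bochner_Integration.integral_cong[OF refl])
    fix z :: "'a \<times> 'a"
    have "g (u, z) = f (fst z) * cnj (f (snd z)) * E (fst z - snd z) u" for u
      by (simp add: g_def case_prod_unfold E_def exp_cnj inner_diff_right exp_diff[symmetric] exp_add[symmetric] algebra_simps)
    then have "(LINT u|N. g (u, z)) = f (fst z) * cnj (f (snd z)) * (LINT u|N. E (fst z - snd z) u)"
      by simp
    also have "(LINT u|N. E (fst z - snd z) u) = cone_kernel (fst z - snd z)"
      unfolding N_def cone_kernel_def set_lebesgue_integral_def B_def[symmetric]
      by (subst integral_restrict_space) (simp_all add: E_def inner_commute)
    finally show "(LINT u|N. g (u, z)) = f (fst z) * cnj (f (snd z)) * cone_kernel (fst z - snd z)" .
  qed
  finally have eq: "complex_of_real (LINT u|N. (norm (F (sgn u)))\<^sup>2)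
      = (LINT z|P. f (fst z) * cnj (f (snd z)) * cone_kernel (fst z - snd z))" .
  have int: "integrable N (\<lambda>u. (norm (F (sgn u)))\<^sup>2)"
  proof -
    have "integrable N (\<lambda>u. LINT z|P. g (u, z))"
      using NP.integrable_fst[of "\<lambda>u z. g (u, z)"] ig2 by simp
    then have "integrable N (\<lambda>u. Re (complex_of_real ((norm (F (sgn u)))\<^sup>2)))"
      unfolding \<open>\<And>u. (LINT z|P. g (u, z)) = complex_of_real ((norm (F (sgn u)))\<^sup>2)\<close>
      by (rule integrable_Re)
    then show ?thesis by simp
  qed
  have "(\<integral>\<^sup>+u. indicator B u * ennreal ((norm (F (sgn u)))\<^sup>2) \<partial>lborel)
      = (\<integral>\<^sup>+u. ennreal ((norm (F (sgn u)))\<^sup>2) \<partial>N)"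
    unfolding N_def by (subst nn_integral_restrict_space) (simp_all add: mult.commute)
  also have "\<dots> = ennreal (LINT u|N. (norm (F (sgn u)))\<^sup>2)"
    by (rule nn_integral_eq_integral[OF int]) simp
  also have "\<dots> = ennreal (norm (complex_of_real (LINT u|N. (norm (F (sgn u)))\<^sup>2)))"
    by simp
  also have "\<dots> \<le> (\<integral>\<^sup>+z. ennreal (norm (f (fst z) * cnj (f (snd z)) * cone_kernel (fst z - snd z))) \<partial>P)"
    unfolding eq using integral_norm_bound_ennreal[of P "\<lambda>z. f (fst z) * cnj (f (snd z)) * cone_kernel (fst z - snd z)"]
    by (cases "integrable P (\<lambda>z. f (fst z) * cnj (f (snd z)) * cone_kernel (fst z - snd z))")
       (simp_all add: not_integrable_integral_eq)
  also have "\<dots> = (\<integral>\<^sup>+x. (\<integral>\<^sup>+y. ennreal (norm (f x) * norm (f y) * norm (cone_kernel (x - y))) \<partial>lborel) \<partial>lborel)"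
    unfolding P_def by (subst lborel.nn_integral_fst[symmetric]) (auto simp: norm_mult)
  finally show ?thesis by (simp add: B_def)
qed

text \<open>
  The pointwise source of Young's convolution inequality, whose exponents satisfy
  \<open>2/p + 1/r = 2\<close>. With \<open>X = a powr p\<close>, \<open>Y = b powr p\<close> and \<open>K = c powr r\<close> the left side is \<open>(X Y)^\<alpha> (X K)^\<beta> (Y K)^\<beta>\<close> with exponents that add up to 1, a weighted
  geometric mean of the three terms on the right, and hence at most their sum.
\<close>
lemma mult3_le_pairwise_sum:
  fixes a b c :: real
  assumes "a \<ge> 0" "b \<ge> 0" "c \<ge> 0" and r: "r > 1"
  defines "p \<equiv> 2 * r / (2 * r - 1)"
  shows "a * b * c \<le> a powr p * b powr p + a powr p * c powr r + b powr p * c powr r"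
proof -
  define X where "X = a powr p"
  define Y where "Y = b powr p"
  define K where "K = c powr r"
  define \<alpha> where "\<alpha> = 1 - 1 / r"
  define \<beta> where "\<beta> = 1 / (2 * r)"
  have nn: "X \<ge> 0" "Y \<ge> 0" "K \<ge> 0" by (simp_all add: X_def Y_def K_def)
  have \<alpha>\<beta>: "\<alpha> > 0" "\<beta> > 0" "\<alpha> + \<beta> + \<beta> = 1" "p * (\<alpha> + \<beta>) = 1" "r * (\<beta> + \<beta>) = 1"
    using r by (simp_all add: \<alpha>_def \<beta>_def p_def field_simps)
  have "X powr (\<alpha> + \<beta>) = a" "Y powr (\<alpha> + \<beta>) = b" "K powr (\<beta> + \<beta>) = c"
    unfolding X_def Y_def K_def powr_powr \<alpha>\<beta>(4,5) using assms by auto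
  then have "a * b * c = X powr (\<alpha> + \<beta>) * Y powr (\<alpha> + \<beta>) * K powr (\<beta> + \<beta>)"
    by simp
  also have "\<dots> = (X * Y) powr \<alpha> * (X * K) powr \<beta> * (Y * K) powr \<beta>"
    using nn by (simp only: powr_add powr_mult mult_ac)
  also have "\<dots> \<le> (X * Y + X * K + Y * K) powr \<alpha> * (X * Y + X * K + Y * K) powr \<beta> * (X * Y + X * K + Y * K) powr \<beta>"
    using nn \<alpha>\<beta> by (intro mult_mono powr_mono2) auto
  also have "\<dots> = (X * Y + X * K + Y * K) powr (\<alpha> + \<beta> + \<beta>)"
    by (simp only: powr_add)
  also have "\<dots> = X * Y + X * K + Y * K"
    using nn by (simp add: \<alpha>\<beta>(3))
  finally show ?thesis by (simp add: X_def Y_def K_def)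
qed

text \<open>
  Young's inequality for the form \<open>\<integral>\<integral> |f x| |f y| |k (x - y)|\<close>, up to a constant and for \<open>f\<close> normalised
  in \<open>L\<^sup>p\<close>. After integrating the pointwise bound, each of the three terms is a product of two
  independent integrals.
\<close>
lemma nn_integral_convolution_form_le:
  fixes f :: "'a::euclidean_space \<Rightarrow> complex" and k :: "'a \<Rightarrow> complex"
  assumes [measurable]: "f \<in> borel_measurable borel" "k \<in> borel_measurable borel"
    and even: "\<And>z. norm (k (- z)) = norm (k z)" and r: "r > 1"
  defines "p \<equiv> 2 * r / (2 * r - 1)"
  assumes f1: "(\<integral>\<^sup>+x. ennreal (norm (f x) powr p) \<partial>lborel) = 1"
  shows "(\<integral>\<^sup>+x. (\<integral>\<^sup>+y. ennreal (norm (f x) * norm (f y) * norm (k (x - y))) \<partial>lborel) \<partial>lborel)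
      \<le> 1 + 2 * (\<integral>\<^sup>+x. ennreal (norm (k x) powr r) \<partial>lborel)"
proof -
  define X where "X x = ennreal (norm (f x) powr p)" for x
  define K where "K x = ennreal (norm (k x) powr r)" for x
  define A where "A = (\<integral>\<^sup>+x. K x \<partial>lborel)"
  have [measurable]: "X \<in> borel_measurable borel" "K \<in> borel_measurable borel"
    unfolding X_def K_def by measurable
  have X1: "(\<integral>\<^sup>+x. X x \<partial>lborel) = 1" using f1 by (simp add: X_def)
  have Keven: "K (x - y) = K (y - x)" for x y
    using even[of "x - y"] by (simp add: K_def)
  have KA: "(\<integral>\<^sup>+y. K (y - x) \<partial>lborel) = A" for x
    using nn_integral_lborel_translate[of K "- x"] by (simp add: A_def)
  have "(\<integral>\<^sup>+x. (\<integral>\<^sup>+y. ennreal (norm (f x) * norm (f y) * norm (k (x - y))) \<partial>lborel) \<partial>lborel)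
     \<le> (\<integral>\<^sup>+x. (\<integral>\<^sup>+y. X x * X y + X x * K (y - x) + X y * K (x - y) \<partial>lborel) \<partial>lborel)"
  proof (intro nn_integral_mono)
    fix x y
    have "ennreal (norm (f x) * norm (f y) * norm (k (x - y))) \<le>
        ennreal (norm (f x) powr p * norm (f y) powr p + norm (f x) powr p * norm (k (x - y)) powr r
          + norm (f y) powr p * norm (k (x - y)) powr r)"
      unfolding p_def by (intro ennreal_leI mult3_le_pairwise_sum r) auto
    also have "\<dots> = X x * X y + X x * K (x - y) + X y * K (x - y)"
      by (simp add: X_def K_def ennreal_mult)
    also have "\<dots> = X x * X y + X x * K (y - x) + X y * K (x - y)"
      by (simp only: Keven)
    finally show "ennreal (norm (f x) * norm (f y) * norm (k (x - y)))
        \<le> X x * X y + X x * K (y - x) + X y * K (x - y)" .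
  qed
  also have "\<dots> = (\<integral>\<^sup>+x. X x + X x * A + (\<integral>\<^sup>+y. X y * K (x - y) \<partial>lborel) \<partial>lborel)"
    by (intro nn_integral_cong) (simp add: nn_integral_add nn_integral_cmult X1 KA)
  also have "\<dots> = 1 + A + (\<integral>\<^sup>+x. (\<integral>\<^sup>+y. X y * K (x - y) \<partial>lborel) \<partial>lborel)"
    by (simp add: nn_integral_add nn_integral_multc X1)
  also have "(\<integral>\<^sup>+x. (\<integral>\<^sup>+y. X y * K (x - y) \<partial>lborel) \<partial>lborel)
      = (\<integral>\<^sup>+y. (\<integral>\<^sup>+x. X y * K (x - y) \<partial>lborel) \<partial>lborel)"
    by (rule lborel_pair.Fubini') measurable
  also have "\<dots> = A"
    by (simp add: nn_integral_cmult nn_integral_multc X1 KA)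
  finally show ?thesis by (simp add: A_def K_def mult_2 add.assoc)
qed

lemma nn_integral_sphere_measure:
  fixes h :: "'a::euclidean_space \<Rightarrow> ennreal"
  assumes [measurable]: "h \<in> borel_measurable borel"
  shows "(\<integral>\<^sup>+\<omega>. h \<omega> \<partial>sphere_measure)
    = of_nat DIM('a) * (\<integral>\<^sup>+u. indicator (cball 0 1 - {0}) u * h (sgn u) \<partial>lborel)"
proof -
  let ?B = "cball 0 1 - {0} :: 'a set"
  have B: "?B \<in> sets borel" by auto
  have m: "sgn \<in> measurable (restrict_space lborel ?B) (restrict_space borel (sphere (0::'a) 1))"
    by (intro measurable_restrict_space2 measurable_restrict_space1) (auto simp: space_restrict_space norm_sgn)
  have h: "h \<in> borel_measurable (restrict_space borel (sphere 0 1))"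
    by (rule measurable_restrict_space1) measurable
  have "(\<integral>\<^sup>+\<omega>. h \<omega> \<partial>sphere_measure)
      = of_nat DIM('a) * (\<integral>\<^sup>+u. h (sgn u) \<partial>restrict_space lborel ?B)"
    unfolding sphere_measure_def
    by (subst nn_integral_scale_measure) (auto simp: nn_integral_distr[OF m] h)
  also have "(\<integral>\<^sup>+u. h (sgn u) \<partial>restrict_space lborel ?B)
      = (\<integral>\<^sup>+u. indicator ?B u * h (sgn u) \<partial>lborel)"
    using B by (subst nn_integral_restrict_space) (auto simp: mult.commute)
  finally show ?thesis .
qed

lemma lebesgue_integrable_borel_version:
  fixes f :: "'a::euclidean_space \<Rightarrow> complex"
  assumes f: "integrable lebesgue f"
  obtains g where "integrable lborel g" "AE x in lebesgue. f x = g x"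
proof -
  have "(\<lambda>x. Re (f x)) \<in> borel_measurable lebesgue" "(\<lambda>x. Im (f x)) \<in> borel_measurable lebesgue"
    using f by auto
  then obtain a b where a: "a \<in> borel_measurable lborel" "AE x in lborel. Re (f x) = a x"
    and b: "b \<in> borel_measurable lborel" "AE x in lborel. Im (f x) = b x"
    using completion_ex_borel_measurable_real[of "\<lambda>x. Re (f x)" lborel]
      completion_ex_borel_measurable_real[of "\<lambda>x. Im (f x)" lborel] by auto
  define g where "g x = Complex (a x) (b x)" for x
  have "g = (\<lambda>x. complex_of_real (a x) + \<i> * complex_of_real (b x))"
    by (simp add: g_def fun_eq_iff complex_eq_iff)
  then have g: "g \<in> borel_measurable lborel" using a b by simp
  have "AE x in lborel. f x = g x" using a(2) b(2)
    by eventually_elim (simp add: g_def complex_eq_iff)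
  then have ae: "AE x in lebesgue. f x = g x" by (rule AE_completion)
  have "integrable lebesgue g"
    using integrable_cong_AE[of f lebesgue g] f ae measurable_completion[OF g] by auto
  then have "integrable lborel g" using integrable_completion[OF g] by simp
  then show ?thesis using ae that by blast
qed

lemma character_lebesgue_measurable:
  "(\<lambda>x::'a::euclidean_space. exp (- (\<i> * complex_of_real (k \<bullet> x)))) \<in> borel_measurable lebesgue"
  by (rule measurable_completion) measurable

lemma fourier_eq_lborel:
  assumes "integrable lborel g" "AE x in lebesgue. f x = g x" "integrable lebesgue f"
  shows "fourier f k = (LINT x|lborel. exp (- (\<i> * complex_of_real (k \<bullet> x))) * g x)"
proof -
  have [measurable]: "g \<in> borel_measurable borel" using assms(1) by simp
  have "fourier f k = (LINT x|lebesgue. exp (- (\<i> * complex_of_real (k \<bullet> x))) * g x)"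
    unfolding fourier_def
  proof (rule integral_cong_AE)
    show "(\<lambda>x. exp (- (\<i> * complex_of_real (k \<bullet> x))) * f x) \<in> borel_measurable lebesgue"
      using assms(3) by (intro borel_measurable_times character_lebesgue_measurable) auto
    show "(\<lambda>x. exp (- (\<i> * complex_of_real (k \<bullet> x))) * g x) \<in> borel_measurable lebesgue"
      by (intro borel_measurable_times character_lebesgue_measurable measurable_completion) measurable
    show "AE x in lebesgue. exp (- (\<i> * complex_of_real (k \<bullet> x))) * f x = exp (- (\<i> * complex_of_real (k \<bullet> x))) * g x"
      using assms(2) by eventually_elim simp
  qed
  also have "\<dots> = (LINT x|lborel. exp (- (\<i> * complex_of_real (k \<bullet> x))) * g x)"
    by (rule integral_completion) measurable
  finally show ?thesis .
qed

lemma fourier_measurable: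
  assumes "integrable lebesgue f"
  shows "fourier f \<in> borel_measurable borel"
proof -
  obtain g where g: "integrable lborel g" "AE x in lebesgue. f x = g x"
    using lebesgue_integrable_borel_version[OF assms] by blast
  have [measurable]: "g \<in> borel_measurable borel" using g(1) by simp
  have "fourier f = (\<lambda>k. LINT x|lborel. exp (- (\<i> * complex_of_real (k \<bullet> x))) * g x)"
    by (rule ext) (rule fourier_eq_lborel[OF g assms])
  also have "\<dots> \<in> borel_measurable borel"
    by (rule sigma_finite_measure.borel_measurable_lebesgue_integral[OF sigma_finite_lborel]) measurable
  finally show ?thesis .
qed

text \<open>
  A restriction theorem of Tomas--Stein type, with an exponent that is far from optimal but above 1.
  For \<open>f\<close> normalised in \<open>L\<^sup>p\<close>, the \<open>T T*\<close> bound and Young's inequality control the square integral of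
  the transform over the sphere by the \<open>L\<^sup>r\<close> integral of the kernel; the general case follows by
  scaling. If no constant with \<open>p > 1\<close> were finite, the set of admissible exponents would always be empty and
  the sharpness assertion would fail.
\<close>
lemma restriction_const_finite:
  assumes dim: "2 \<le> DIM('a::euclidean_space)"
  defines "r \<equiv> 3 * (real DIM('a) + 2)"
  defines "p \<equiv> 2 * r / (2 * r - 1)"
  shows "restriction_const TYPE('a) p 2 < \<infinity>"
proof -
  define A where "A = (\<integral>\<^sup>+x. ennreal (norm (cone_kernel (x::'a)) powr r) \<partial>lborel)"
  have r: "r > 1" by (simp add: r_def)
  have p: "p > 1" using r by (simp add: p_def field_simps)
  have A: "A < \<infinity>"
  proof -
    have "norm (cone_kernel x) powr r = norm (cone_kernel x) ^ (3 * (DIM('a) + 2))" for x :: 'a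
      using powr_realpow'[of "norm (cone_kernel x)" "3 * (DIM('a) + 2)"]
      by (simp add: r_def algebra_simps)
    then show ?thesis using cone_kernel_power_integrable[OF dim] by (simp add: A_def)
  qed
  \<comment> \<open>The square of the final bound: the factor \<open>DIM('a)\<close> comes from the surface measure, and \<open>1 + 2 * A\<close>
    from Young's inequality.\<close>
  define C where "C = sqrt (enn2real (of_nat DIM('a) * (1 + 2 * A)))"
  have C2: "ennreal (C\<^sup>2) = of_nat DIM('a) * (1 + 2 * A)"
    using A by (simp add: C_def ennreal_enn2real ennreal_mult_less_top of_nat_less_top)
  have C: "C \<ge> 0" by (simp add: C_def)
  have "restriction_const TYPE('a) p 2 \<le> ennreal C"
    unfolding restriction_const_def
  proof (rule SUP_least, safe)
    fix f :: "'a \<Rightarrow> complex"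
    assume f: "integrable lebesgue f" and fin: "Lp_norm lebesgue p f < \<infinity>"
      and nz: "\<not> (AE x in lebesgue. f x = 0)"
    obtain g where g: "integrable lborel g" "AE x in lebesgue. f x = g x"
      using lebesgue_integrable_borel_version[OF f] by blast
    have [measurable]: "g \<in> borel_measurable borel" using g(1) by simp
    define P where "P = (\<integral>\<^sup>+x. ennreal (norm (f x) powr p) \<partial>lebesgue)"
    have Pg: "P = (\<integral>\<^sup>+x. ennreal (norm (g x) powr p) \<partial>lborel)"
      unfolding P_def nn_integral_completion[symmetric, of lborel]
      using g(2) by (intro nn_integral_cong_AE) auto
    have Pfin: "P \<noteq> \<infinity>"
      using fin by (auto simp: Lp_norm_def ennreal_powr_def P_def)
    have P0: "P \<noteq> 0"
    proof
      assume "P = 0"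
      then have "AE x in lborel. ennreal (norm (g x) powr p) = 0"
        unfolding Pg by (subst (asm) nn_integral_0_iff_AE) auto
      then have "AE x in lebesgue. g x = 0"
        by (intro AE_completion) auto
      then have "AE x in lebesgue. f x = 0" using g(2) by eventually_elim simp
      then show False using nz by simp
    qed
    define s where "s = enn2real P powr (1 / p)"
    have P: "P = ennreal (enn2real P)" "enn2real P > 0"
      using Pfin P0 by (auto simp: enn2real_positive_iff less_top zero_less_iff_neq_zero)
    have s: "s > 0" using P by (simp add: s_def)
    have sp: "s powr p = enn2real P" using P(2) p by (simp add: s_def powr_powr)
    have Lp: "Lp_norm lebesgue p f = ennreal s"
      using Pfin by (simp add: Lp_norm_def ennreal_powr_def P_def s_def)
    define h where "h x = g x / complex_of_real s" for x
    have [measurable]: "h \<in> borel_measurable borel" unfolding h_def by measurable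
    have ih: "integrable lborel h" unfolding h_def using g(1) by simp
    have h1: "(\<integral>\<^sup>+x. ennreal (norm (h x) powr p) \<partial>lborel) = 1"
    proof -
      have "ennreal (norm (h x) powr p) = ennreal (1 / enn2real P) * ennreal (norm (g x) powr p)" for x
        using s P(2) by (simp add: h_def norm_divide powr_divide sp ennreal_mult[symmetric])
      then have "(\<integral>\<^sup>+x. ennreal (norm (h x) powr p) \<partial>lborel) = ennreal (1 / enn2real P) * P"
        by (simp add: nn_integral_cmult Pg)
      also have "\<dots> = ennreal (1 / enn2real P * enn2real P)"
        using P(2) by (subst P(1)) (simp flip: ennreal_mult)
      finally show ?thesis using P(2) by simp
    qed
    define H where "H k = (LINT x|lborel. exp (- (\<i> * complex_of_real (k \<bullet> x))) * h x)" for k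
    have four: "fourier f k = complex_of_real s * H k" for k
      unfolding fourier_eq_lborel[OF g f] H_def h_def using s by simp
    have [measurable]: "fourier f \<in> borel_measurable borel" by (rule fourier_measurable[OF f])
    have H_eq: "H k = fourier f k / complex_of_real s" for k using four s by simp
    have [measurable]: "H \<in> borel_measurable borel" unfolding H_eq[abs_def] by measurable
    have [measurable]: "cball (0::'a) 1 - {0} \<in> sets borel" by auto
    have "(\<integral>\<^sup>+u. indicator (cball 0 1 - {0}) u * ennreal ((norm (H (sgn u)))\<^sup>2) \<partial>lborel) \<le> 1 + 2 * A"
      using fourier_square_integral_le[OF ih, folded H_def]
        nn_integral_convolution_form_le[of h cone_kernel r, folded p_def, OF _ _ _ r h1]
      by (auto simp: A_def cone_kernel_minus intro: order_trans)
    then have "(\<integral>\<^sup>+\<omega>. ennreal ((norm (H \<omega>))\<^sup>2) \<partial>sphere_measure) \<le> ennreal (C\<^sup>2)"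
      unfolding C2 by (subst nn_integral_sphere_measure) (auto intro: mult_left_mono)
    then have "ennreal (s\<^sup>2) * (\<integral>\<^sup>+\<omega>. ennreal ((norm (H \<omega>))\<^sup>2) \<partial>sphere_measure) \<le> ennreal (s\<^sup>2) * ennreal (C\<^sup>2)"
      by (rule mult_left_mono) simp
    also have "\<dots> = ennreal ((s * C)\<^sup>2)" by (simp add: ennreal_mult power_mult_distrib)
    also have "ennreal (s\<^sup>2) * (\<integral>\<^sup>+\<omega>. ennreal ((norm (H \<omega>))\<^sup>2) \<partial>sphere_measure)
        = (\<integral>\<^sup>+\<omega>. ennreal (norm (fourier f \<omega>) powr 2) \<partial>sphere_measure)"
    proof (subst nn_integral_cmult[symmetric])
      have "sets (sphere_measure :: 'a measure) = sets (restrict_space borel (sphere 0 1))"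
        by (rule sets_sphere_measure)
      then show "(\<lambda>\<omega>. ennreal ((norm (H \<omega>))\<^sup>2)) \<in> borel_measurable sphere_measure"
        by (subst measurable_cong_sets[OF _ refl]) (auto intro!: measurable_restrict_space1)
      show "(\<integral>\<^sup>+\<omega>. ennreal (s\<^sup>2) * ennreal ((norm (H \<omega>))\<^sup>2) \<partial>sphere_measure)
          = (\<integral>\<^sup>+\<omega>. ennreal (norm (fourier f \<omega>) powr 2) \<partial>sphere_measure)"
        using s by (intro nn_integral_cong)
          (simp add: four norm_mult powr_numeral power_mult_distrib ennreal_mult)
    qed
    finally have Q: "(\<integral>\<^sup>+\<omega>. ennreal (norm (fourier f \<omega>) powr 2) \<partial>sphere_measure) \<le> ennreal ((s * C)\<^sup>2)" (is "?Q \<le> _") .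
    then have "?Q \<noteq> \<infinity>" by (auto simp: top_unique)
    have "enn2real ?Q \<le> (s * C)\<^sup>2"
      using Q by (intro enn2real_leI) auto
    then have "enn2real ?Q powr (1/2) \<le> s * C"
      using s C by (simp add: powr_half_sqrt real_le_lsqrt)
    then have "Lp_norm sphere_measure 2 (fourier f) \<le> ennreal (s * C)"
      using \<open>?Q \<noteq> \<infinity>\<close> by (simp add: Lp_norm_def ennreal_powr_def ennreal_leI)
    also have "\<dots> = ennreal C * ennreal s" using s C by (simp add: ennreal_mult mult.commute)
    finally show "Lp_norm sphere_measure 2 (fourier f) / Lp_norm lebesgue p f \<le> ennreal C"
      unfolding Lp using s by (metis ennreal_less_zero_iff divide_le_posI_ennreal mult.commute)
  qed
  also have "\<dots> < \<infinity>" by simp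
  finally show ?thesis .
qed

section \<open>The estimate between the grand norms\<close>

lemma ennreal_powr_mono:
  assumes "x \<le> y" "r \<ge> 0" shows "ennreal_powr x r \<le> ennreal_powr y r"
proof (cases "y = \<infinity>")
  case False
  then have "x \<noteq> \<infinity>" using assms by (auto simp: top_unique)
  then show ?thesis using False assms
    by (auto simp: ennreal_powr_def intro!: ennreal_leI powr_mono2 enn2real_mono simp: less_top)
qed (simp add: ennreal_powr_def)

lemma ennreal_powr_ennreal: "c \<ge> 0 \<Longrightarrow> ennreal_powr (ennreal c) r = ennreal (c powr r)"
  by (simp add: ennreal_powr_def)

text \<open>
  Passes strict lower bounds through the outer root in \<open>Lp_norm\<close>, including the value \<open>\<infinity>\<close>.
\<close>
lemma less_ennreal_powr_iff:
  assumes "c \<ge> 0" "r > 0"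
  shows "ennreal c < ennreal_powr x r \<longleftrightarrow> ennreal (c powr (1 / r)) < x"
proof (cases x)
  case (real y)
  have "c < y powr r \<longleftrightarrow> c powr (1 / r) < y"
  proof
    assume "c < y powr r"
    then have "c powr (1/r) < (y powr r) powr (1/r)"
      using assms by (intro powr_less_mono2) auto
    then show "c powr (1/r) < y" using real assms by (simp add: powr_powr)
  next
    assume "c powr (1/r) < y"
    then have "(c powr (1/r)) powr r < y powr r"
      using assms by (intro powr_less_mono2) auto
    then show "c < y powr r" using assms by (simp add: powr_powr)
  qed
  then show ?thesis using real assms by (simp add: ennreal_powr_def ennreal_less_iff)
qed (use assms in \<open>simp add: ennreal_powr_def\<close>)

lemma Lp_norm_AE_zero:
  assumes "AE x in M. f x = 0"
  shows "Lp_norm M p f = 0"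
proof -
  have "(\<integral>\<^sup>+x. ennreal (norm (f x) powr p) \<partial>M) = (\<integral>\<^sup>+x. 0 \<partial>M)"
    using assms by (intro nn_integral_cong_AE) auto
  then show ?thesis by (simp add: Lp_norm_def ennreal_powr_def)
qed

lemma Lp_norm_eq_0D:
  assumes [measurable]: "f \<in> borel_measurable M" and 0: "Lp_norm M p f = 0" and "p > 0"
  shows "AE x in M. f x = 0"
proof -
  have "(\<integral>\<^sup>+x. ennreal (norm (f x) powr p) \<partial>M) = 0" (is "?I = 0")
  proof (rule ccontr)
    assume "?I \<noteq> 0"
    then have "ennreal 0 < ennreal_powr ?I (1 / p)"
      using \<open>p > 0\<close> by (subst less_ennreal_powr_iff) (auto simp: zero_less_iff_neq_zero)
    then show False using 0 by (simp add: Lp_norm_def)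
  qed
  then show ?thesis
    by (subst (asm) nn_integral_0_iff_AE) auto
qed

lemma fourier_AE_zero:
  assumes "AE x in lebesgue. f x = 0"
  shows "fourier f k = 0"
  unfolding fourier_def using assms by (intro integral_eq_zero_AE) auto

lemma ennreal_divide_mult_cancel:
  fixes x y :: ennreal
  assumes "y \<noteq> 0" "y \<noteq> \<infinity>"
  shows "x / y * y = x"
  using assms by (simp add: ennreal_divide_times ennreal_divide_self less_top)

text \<open>
  The restriction constant as an operator norm. The supremum defining it excludes the zero
  function, for which both sides vanish; so \<open>\<infinity> * 0 = 0\<close> makes the estimate correct even where the
  constant is infinite.
\<close>
lemma Lp_norm_fourier_le:
  fixes f :: "'a::euclidean_space \<Rightarrow> complex"
  assumes f: "integrable lebesgue f" and fin: "Lp_norm lebesgue p f < \<infinity>" and "p > 0"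
  shows "Lp_norm sphere_measure q (fourier f) \<le> restriction_const TYPE('a) p q * Lp_norm lebesgue p f"
proof (cases "AE x in lebesgue. f x = 0")
  case True
  then have "fourier f = (\<lambda>k. 0)" by (intro ext fourier_AE_zero)
  then show ?thesis by (simp add: Lp_norm_AE_zero)
next
  case False
  then have "Lp_norm lebesgue p f \<noteq> 0"
    using Lp_norm_eq_0D[of f lebesgue p] f \<open>p > 0\<close> by auto
  moreover have "Lp_norm sphere_measure q (fourier f) / Lp_norm lebesgue p f \<le> restriction_const TYPE('a) p q"
    unfolding restriction_const_def using f fin False by (intro SUP_upper) auto
  then have "Lp_norm sphere_measure q (fourier f) / Lp_norm lebesgue p f * Lp_norm lebesgue p f
      \<le> restriction_const TYPE('a) p q * Lp_norm lebesgue p f"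
    by (rule mult_right_mono) simp
  ultimately show ?thesis
    using fin by (simp add: ennreal_divide_mult_cancel)
qed

text \<open>
  Holds for \<open>y = 0\<close> too, since then \<open>x = 0\<close> and \<open>0 / 0 = 0\<close>.
\<close>
lemma ennreal_divide_leI:
  fixes x y c :: ennreal
  assumes "x \<le> c * y" "y \<noteq> \<infinity>"
  shows "x / y \<le> c"
proof (cases "y = 0")
  case False
  have "x / y \<le> c * y / y" by (rule divide_right_mono_ennreal) fact
  then show ?thesis using False assms by (simp add: ennreal_mult_divide_eq)
qed (use assms in simp)

lemma ennreal_le_mult_INF:
  fixes x G :: ennreal
  assumes "\<And>i. i \<in> I \<Longrightarrow> x \<le> G * h i" "G \<noteq> \<infinity>" "I \<noteq> {}"
  shows "x \<le> G * (INF i\<in>I. h i)"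
proof (cases "G = 0")
  case False
  have "x / G \<le> (INF i\<in>I. h i)"
    using assms by (intro INF_greatest ennreal_divide_leI) (auto simp: mult.commute)
  then have "x / G * G \<le> (INF i\<in>I. h i) * G" by (rule mult_right_mono) simp
  moreover have "x / G * G = x" using False assms(2) by (rule ennreal_divide_mult_cancel)
  ultimately show ?thesis by (simp add: mult.commute)
qed (use assms in auto)

text \<open>
  By definition of the norm, \<open>\<parallel>f\<parallel>\<^sub>p \<le> G * \<psi> p\<close> with \<open>G\<close> the grand norm of \<open>f\<close>, for every \<open>p\<close>. Hence
  \<open>\<parallel>fourier f\<parallel>\<^sub>q \<le> K p q * \<psi> p * G\<close> for every \<open>p\<close>, and the infimum over \<open>p\<close> of the right side is
  \<open>zeta q * G\<close>. Admissibility of \<open>q\<close> makes \<open>zeta q\<close> finite, which allows the division.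
\<close>
lemma grand_norm_fourier_le:
  fixes f :: "'a::euclidean_space \<Rightarrow> complex"
  assumes a: "1 < a" and \<psi>: "\<psi> \<in> Psi a b" and f: "f \<in> GLS a b \<psi>"
  shows "sphere_gls_norm a b \<psi> (fourier f) \<le> gls_norm a b \<psi> f"
  unfolding sphere_gls_norm_def grand_norm_def
proof (rule SUP_least)
  fix q assume q: "q \<in> restriction_exponents TYPE('a) a b"
  define G where "G = gls_norm a b \<psi> f"
  have G: "G < \<infinity>" and fi: "integrable lebesgue f" using f by (auto simp: GLS_def G_def)
  have pos: "\<psi> p > 0" if "p \<in> {a<..<b}" for p using \<psi> that by (auto simp: Psi_def)
  have Lp: "Lp_norm lebesgue p f \<le> G * ennreal (\<psi> p)" if p: "p \<in> {a<..<b}" for p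
  proof -
    have "Lp_norm lebesgue p f / ennreal (\<psi> p) \<le> G"
      unfolding G_def gls_norm_def grand_norm_def using p by (rule SUP_upper)
    then have "Lp_norm lebesgue p f / ennreal (\<psi> p) * ennreal (\<psi> p) \<le> G * ennreal (\<psi> p)"
      by (rule mult_right_mono) simp
    then show ?thesis using pos[OF p]
      by (simp add: ennreal_divide_mult_cancel)
  qed
  have le: "Lp_norm sphere_measure q (fourier f) \<le> G * (ennreal (\<psi> p) * restriction_const TYPE('a) p q)"
    if p: "p \<in> {a<..<b}" for p
  proof -
    have "G * ennreal (\<psi> p) < \<infinity>" using G by (simp add: ennreal_mult_less_top)
    then have "Lp_norm lebesgue p f < \<infinity>" using Lp[OF p] by (rule le_less_trans[rotated])
    then have "Lp_norm sphere_measure q (fourier f) \<le> restriction_const TYPE('a) p q * Lp_norm lebesgue p f"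
      using a p by (intro Lp_norm_fourier_le fi) auto
    also have "\<dots> \<le> restriction_const TYPE('a) p q * (G * ennreal (\<psi> p))"
      by (intro mult_left_mono Lp p) auto
    finally show ?thesis by (simp add: mult_ac)
  qed
  obtain p0 where p0: "p0 \<in> {a<..<b}" "restriction_const TYPE('a) p0 q < \<infinity>"
    using q by (auto simp: restriction_exponents_def)
  have "zeta TYPE('a) a b \<psi> q \<le> ennreal (\<psi> p0) * restriction_const TYPE('a) p0 q"
    unfolding zeta_def by (rule INF_lower) (rule p0)
  also have "\<dots> < \<infinity>" using p0(2) by (simp add: ennreal_mult_less_top)
  finally have zfin: "zeta TYPE('a) a b \<psi> q < \<infinity>" .
  have "Lp_norm sphere_measure q (fourier f) \<le> G * zeta TYPE('a) a b \<psi> q"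
    unfolding zeta_def using le G p0(1) by (intro ennreal_le_mult_INF) auto
  then show "Lp_norm sphere_measure q (fourier f) / zeta TYPE('a) a b \<psi> q \<le> gls_norm a b \<psi> f"
    unfolding G_def[symmetric] using zfin by (intro ennreal_divide_leI) auto
qed

section \<open>Near-extremizers and sharpness\<close>

lemma measurable_sphere_measure:
  assumes "h \<in> borel_measurable borel" shows "h \<in> borel_measurable sphere_measure"
  by (subst measurable_cong_sets[OF sets_sphere_measure refl]) (rule measurable_restrict_space1[OF assms])

text \<open>
  Test with the indicator of the unit ball: on the unit sphere the phase \<open>k \<bullet> x\<close> stays in \<open>[-1, 1]\<close>,
  so the real part of the transform is at least \<open>cos 1\<close> times the volume of the ball. A vanishing
  constant would force the transform to vanish almost everywhere on the sphere.
\<close>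
lemma restriction_const_pos:
  assumes "p > 0" "q > 0"
  shows "restriction_const TYPE('a::euclidean_space) p q > 0"
proof (rule ccontr)
  assume "\<not> ?thesis"
  then have K0: "restriction_const TYPE('a) p q = 0" by (simp add: zero_less_iff_neq_zero)
  define f :: "'a \<Rightarrow> complex" where "f x = complex_of_real (indicat_real (cball 0 1) x)" for x
  define V where "V = measure lebesgue (cball (0::'a) 1)"
  have Vpos: "V > 0" by (simp add: V_def content_cball_pos)
  have Vfin: "emeasure lebesgue (cball (0::'a) 1) < \<infinity>"
    using emeasure_lborel_cball_finite[of "0::'a" 1] by simp
  have iind: "integrable lebesgue (indicat_real (cball (0::'a) 1))"
    using Vfin by (simp add: integrable_indicator_iff)
  have f: "integrable lebesgue f"
    unfolding f_def by (rule integrable_of_real[OF iind])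
  have "(\<integral>\<^sup>+x. ennreal (norm (f x) powr p) \<partial>lebesgue) = (\<integral>\<^sup>+x. indicator (cball (0::'a) 1) x \<partial>lebesgue)"
    using \<open>p > 0\<close> by (intro nn_integral_cong) (auto simp: f_def indicator_def)
  also have "\<dots> < \<infinity>" using Vfin by simp
  finally have "Lp_norm lebesgue p f < \<infinity>"
    by (simp add: Lp_norm_def ennreal_powr_def)
  then have "Lp_norm sphere_measure q (fourier f) = 0"
    using Lp_norm_fourier_le[OF f, of p q] K0 \<open>p > 0\<close> by simp
  then have ae0: "AE k in sphere_measure. fourier f k = 0"
    using \<open>q > 0\<close> fourier_measurable[OF f] by (intro Lp_norm_eq_0D measurable_sphere_measure)
  have ne: "fourier f k \<noteq> 0" if k: "norm k = 1" for k
  proof -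
    define e where "e x = exp (- (\<i> * complex_of_real (k \<bullet> x))) * f x" for x
    have "e \<in> borel_measurable lebesgue"
      unfolding e_def using f by (intro borel_measurable_times character_lebesgue_measurable) auto
    then have ie: "integrable lebesgue e"
      by (rule Bochner_Integration.integrable_bound[OF f]) (auto simp: e_def norm_mult)
    have "0 < cos 1 * V" using Vpos cos_gt_zero_pi[of 1] pi_gt3 by simp
    also have "cos 1 * V = (LINT x|lebesgue. cos 1 * indicat_real (cball (0::'a) 1) x)"
      by (simp add: V_def)
    also have "\<dots> \<le> (LINT x|lebesgue. Re (e x))"
    proof (rule integral_mono)
      show "integrable lebesgue (\<lambda>x. Re (e x))" using ie by simp
      show "integrable lebesgue (\<lambda>x. cos 1 * indicat_real (cball (0::'a) 1) x)" using iind by simp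
      fix x :: 'a
      show "cos 1 * indicat_real (cball 0 1) x \<le> Re (e x)"
      proof (cases "x \<in> cball 0 1")
        case True
        have "\<bar>k \<bullet> x\<bar> \<le> norm k * norm x" by (rule Cauchy_Schwarz_ineq2)
        then have "\<bar>k \<bullet> x\<bar> \<le> 1" using k True by simp
        then have "cos 1 \<le> cos \<bar>k \<bullet> x\<bar>" using pi_gt3 by (intro cos_monotone_0_pi_le) auto
        then show ?thesis using True by (simp add: e_def f_def Re_exp)
      qed (simp add: e_def f_def)
    qed
    also have "\<dots> = Re (fourier f k)"
      unfolding fourier_def e_def[symmetric] by (rule integral_Re[OF ie])
    finally show ?thesis by auto
  qed
  have "AE k in (sphere_measure :: 'a measure). k \<in> sphere 0 1"
    using AE_space[of "sphere_measure :: 'a measure"] by (simp add: space_sphere_measure)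
  then have "AE k in (sphere_measure :: 'a measure). False"
    using ae0 by eventually_elim (use ne in auto)
  then have "(\<integral>\<^sup>+k. 1 \<partial>(sphere_measure :: 'a measure)) = (\<integral>\<^sup>+k. 0 \<partial>(sphere_measure :: 'a measure))"
    by (intro nn_integral_cong_AE) auto
  then have "emeasure lborel (cball (0::'a) 1 - {0}) = 0"
    using nn_integral_sphere_measure[of "\<lambda>_::'a. 1"] by (simp add: mult_eq_0_iff)
  moreover have "emeasure lborel (cball (0::'a) 1 - {0}) = emeasure lborel (cball (0::'a) 1)"
    by (rule emeasure_Diff_null_set) auto
  ultimately show False using Vpos by (simp add: V_def measure_def)
qed

lemma Lp_norm_mono:
  assumes "\<And>x. norm (f x) \<le> norm (g x)" "p > 0"
  shows "Lp_norm M p f \<le> Lp_norm M p g"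
  unfolding Lp_norm_def using assms
  by (intro ennreal_powr_mono nn_integral_mono ennreal_leI powr_mono2) auto

text \<open>
  Dominated convergence gives pointwise convergence of the transforms, and Fatou's lemma on the
  sphere turns it into the lower bound.
\<close>
lemma Lp_norm_fourier_lower_semicontinuous:
  fixes g :: "nat \<Rightarrow> 'a::euclidean_space \<Rightarrow> complex"
  assumes g: "\<And>n. integrable lebesgue (g n)" and f: "integrable lebesgue f"
    and dom: "\<And>n x. norm (g n x) \<le> norm (f x)" and lim: "\<And>x. (\<lambda>n. g n x) \<longlonglongrightarrow> f x"
    and "q > 0" "c \<ge> 0" and c: "ennreal c < Lp_norm sphere_measure q (fourier f)"
  shows "\<exists>n. ennreal c < Lp_norm sphere_measure q (fourier (g n))"
proof -
  have conv: "(\<lambda>n. fourier (g n) k) \<longlonglongrightarrow> fourier f k" for k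
    unfolding fourier_def
  proof (rule integral_dominated_convergence[where w = "\<lambda>x. norm (f x)"])
    show "(\<lambda>x. exp (- (\<i> * complex_of_real (k \<bullet> x))) * f x) \<in> borel_measurable lebesgue"
      "(\<lambda>x. exp (- (\<i> * complex_of_real (k \<bullet> x))) * g n x) \<in> borel_measurable lebesgue" for n
      using f g[of n] by (intro borel_measurable_times character_lebesgue_measurable, auto)+
    show "integrable lebesgue (\<lambda>x. norm (f x))" using f by simp
    show "AE x in lebesgue. (\<lambda>n. exp (- (\<i> * complex_of_real (k \<bullet> x))) * g n x)
        \<longlonglongrightarrow> exp (- (\<i> * complex_of_real (k \<bullet> x))) * f x"
      by (intro AE_I2 tendsto_mult tendsto_const lim)
    show "AE x in lebesgue. norm (exp (- (\<i> * complex_of_real (k \<bullet> x))) * g n x) \<le> norm (f x)" for n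
      using dom by (intro AE_I2) (simp add: norm_mult)
  qed
  let ?u = "\<lambda>n k. ennreal (norm (fourier (g n) k) powr q)"
  have "(\<lambda>n. ?u n k) \<longlonglongrightarrow> ennreal (norm (fourier f k) powr q)" for k
    using \<open>q > 0\<close> by (intro tendsto_ennrealI tendsto_powr' tendsto_norm conv tendsto_const) auto
  then have liminf_eq: "liminf (\<lambda>n. ?u n k) = ennreal (norm (fourier f k) powr q)" for k
    by (intro lim_imp_Liminf) auto
  have "ennreal (c powr q) < (\<integral>\<^sup>+k. ennreal (norm (fourier f k) powr q) \<partial>sphere_measure)"
    using c \<open>c \<ge> 0\<close> \<open>q > 0\<close> by (simp add: Lp_norm_def less_ennreal_powr_iff)
  also have "\<dots> = (\<integral>\<^sup>+k. liminf (\<lambda>n. ?u n k) \<partial>sphere_measure)"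
    by (simp only: liminf_eq)
  also have "\<dots> \<le> liminf (\<lambda>n. \<integral>\<^sup>+k. ?u n k \<partial>sphere_measure)"
  proof (rule nn_integral_liminf)
    fix n
    note [measurable] = measurable_sphere_measure[OF fourier_measurable[OF g[of n]]]
    show "?u n \<in> borel_measurable sphere_measure" by measurable
  qed
  finally have "\<forall>\<^sub>F n in sequentially. ennreal (c powr q) < (\<integral>\<^sup>+k. ?u n k \<partial>sphere_measure)"
    by (rule less_LiminfD)
  then obtain n where "ennreal (c powr q) < (\<integral>\<^sup>+k. ?u n k \<partial>sphere_measure)"
    using eventually_happens'[OF sequentially_bot] by blast
  then show ?thesis
    using \<open>c \<ge> 0\<close> \<open>q > 0\<close> by (auto simp: Lp_norm_def less_ennreal_powr_iff)
qed

text \<open>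
  The supremum in the restriction constant may be taken over bounded functions: truncating a
  near-extremizer at a high level does not increase its \<open>L\<^sup>p\<close> norm, and by lower semicontinuity it
  hardly decreases the norm of the transform. Boundedness matters below because it puts the function
  in \<open>L\<^sup>p\<close> for exponents on both sides of the given one.
\<close>
lemma bounded_near_extremizer:
  fixes C :: ennreal
  defines "K \<equiv> restriction_const TYPE('a::euclidean_space)"
  assumes "C < 1" and fin: "K p q < \<infinity>" and "p > 0" "q > 0"
  obtains f :: "'a::euclidean_space \<Rightarrow> complex" and M where
    "integrable lebesgue f" "\<And>x. norm (f x) \<le> M" "Lp_norm lebesgue p f < \<infinity>" "Lp_norm lebesgue p f \<noteq> 0"
    "C * (K p q * Lp_norm lebesgue p f) < Lp_norm sphere_measure q (fourier f)"
proof -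
  \<comment> \<open>Positivity of the constant is what makes \<open>C * K p q\<close> strictly smaller than it.\<close>
  have Kpos: "K p q > 0" unfolding K_def by (rule restriction_const_pos) fact+
  then have "C * K p q < 1 * K p q"
    using \<open>C < 1\<close> fin by (intro ennreal_mult_strict_right_mono) auto
  then have "C * K p q < K p q" by simp
  then obtain f :: "'a \<Rightarrow> complex" where f: "integrable lebesgue f" "Lp_norm lebesgue p f < \<infinity>"
      "\<not> (AE x in lebesgue. f x = 0)"
    and less: "C * K p q < Lp_norm sphere_measure q (fourier f) / Lp_norm lebesgue p f"
    unfolding K_def restriction_const_def less_SUP_iff by auto
  have L0: "Lp_norm lebesgue p f \<noteq> 0"
    using Lp_norm_eq_0D[of f lebesgue p] f \<open>p > 0\<close> by auto
  have "C * K p q * Lp_norm lebesgue p f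
      < Lp_norm sphere_measure q (fourier f) / Lp_norm lebesgue p f * Lp_norm lebesgue p f"
    using less L0 f(2) by (intro ennreal_mult_strict_right_mono) (auto simp: zero_less_iff_neq_zero)
  also have "\<dots> = Lp_norm sphere_measure q (fourier f)"
    using L0 f(2) by (intro ennreal_divide_mult_cancel) auto
  finally have less': "C * K p q * Lp_norm lebesgue p f < Lp_norm sphere_measure q (fourier f)" .
  have "C * K p q * Lp_norm lebesgue p f < \<infinity>"
    using less' by (simp add: less_le_trans[OF _ top_greatest])
  then obtain c where c: "c \<ge> 0" "C * K p q * Lp_norm lebesgue p f = ennreal c"
    by (cases "C * K p q * Lp_norm lebesgue p f") auto
  define g where "g n x = (if norm (f x) \<le> real n then f x else 0)" for n x
  have g_int: "integrable lebesgue (g n)" for n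
  proof (rule Bochner_Integration.integrable_bound[OF f(1)])
    have [measurable]: "f \<in> borel_measurable lebesgue" using f(1) by auto
    show "g n \<in> borel_measurable lebesgue" unfolding g_def by measurable
  qed (auto simp: g_def)
  have g_le: "norm (g n x) \<le> norm (f x)" for n x by (simp add: g_def)
  have g_lim: "(\<lambda>n. g n x) \<longlonglongrightarrow> f x" for x
  proof (rule tendsto_eventually)
    show "\<forall>\<^sub>F n in sequentially. g n x = f x"
      using eventually_ge_at_top[of "nat \<lceil>norm (f x)\<rceil>"]
      by eventually_elim (auto simp: g_def; linarith)
  qed
  obtain n where n: "ennreal c < Lp_norm sphere_measure q (fourier (g n))"
    using Lp_norm_fourier_lower_semicontinuous[OF g_int f(1) g_le g_lim \<open>q > 0\<close> c(1)] less' c(2) by auto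
  have gf: "Lp_norm lebesgue p (g n) \<le> Lp_norm lebesgue p f"
    using g_le \<open>p > 0\<close> by (rule Lp_norm_mono)
  show ?thesis
  proof (rule that[of "g n" "real n"])
    show "integrable lebesgue (g n)" by (rule g_int)
    show "norm (g n x) \<le> real n" for x by (simp add: g_def)
    show gfin: "Lp_norm lebesgue p (g n) < \<infinity>" using gf f(2) by (rule le_less_trans)
    show "Lp_norm lebesgue p (g n) \<noteq> 0"
    proof
      assume "Lp_norm lebesgue p (g n) = 0"
      then have "Lp_norm sphere_measure q (fourier (g n)) = 0"
        using Lp_norm_fourier_le[OF g_int gfin \<open>p > 0\<close>, of q] by simp
      then show False using n by simp
    qed
    have "C * (K p q * Lp_norm lebesgue p (g n)) \<le> C * (K p q * Lp_norm lebesgue p f)"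
      using gf by (intro mult_left_mono) auto
    also have "\<dots> = ennreal c" using c(2) by (simp add: mult.assoc)
    also note n
    finally show "C * (K p q * Lp_norm lebesgue p (g n)) < Lp_norm sphere_measure q (fourier (g n))" .
  qed
qed

text \<open>
  From \<open>|f|\<^sup>p \<le> B\<^sup>p |f|\<close>. The point is that the bound does not depend on \<open>p\<close>.
\<close>
lemma Lp_norm_bounded_le:
  assumes f: "integrable M f" and B: "\<And>x. norm (f x) \<le> B" "B \<ge> 1" and "p \<ge> 1"
  shows "Lp_norm M p f \<le> ennreal (B * max 1 (LINT x|M. norm (f x)))"
proof -
  define N where "N = max 1 (LINT x|M. norm (f x))"
  have N: "N \<ge> 1" by (simp add: N_def)
  have pw: "norm (f x) powr p \<le> B powr p * norm (f x)" for x
  proof (cases "f x = 0")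
    case False
    have "norm (f x) powr p = norm (f x) powr (p - 1) * norm (f x)"
      using False powr_add[of "norm (f x)" "p - 1" 1] by simp
    also have "\<dots> \<le> B powr p * norm (f x)"
    proof (intro mult_right_mono)
      have "norm (f x) powr (p - 1) \<le> B powr (p - 1)"
        using B \<open>p \<ge> 1\<close> by (intro powr_mono2) auto
      also have "\<dots> \<le> B powr p" using B by (intro powr_mono) auto
      finally show "norm (f x) powr (p - 1) \<le> B powr p" .
    qed simp
    finally show ?thesis .
  qed simp
  have "(\<integral>\<^sup>+x. ennreal (norm (f x) powr p) \<partial>M) \<le> (\<integral>\<^sup>+x. ennreal (B powr p * norm (f x)) \<partial>M)"
    by (intro nn_integral_mono ennreal_leI pw)
  also have "\<dots> = ennreal (LINT x|M. B powr p * norm (f x))"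
    using f by (intro nn_integral_eq_integral) auto
  also have "\<dots> \<le> ennreal ((B * N) powr p)"
  proof (rule ennreal_leI)
    have "N \<le> N powr p" using N \<open>p \<ge> 1\<close> powr_mono[of 1 p N] by simp
    then have "(LINT x|M. norm (f x)) \<le> N powr p" by (simp add: N_def)
    then have "B powr p * (LINT x|M. norm (f x)) \<le> B powr p * N powr p"
      by (intro mult_left_mono) auto
    then show "(LINT x|M. B powr p * norm (f x)) \<le> (B * N) powr p"
      using B N by (simp add: powr_mult)
  qed
  finally have "Lp_norm M p f \<le> ennreal_powr (ennreal ((B * N) powr p)) (1 / p)"
    unfolding Lp_norm_def using \<open>p \<ge> 1\<close> by (intro ennreal_powr_mono) auto
  also have "\<dots> = ennreal (B * N)"
    using \<open>p \<ge> 1\<close> B N by (simp add: ennreal_powr_ennreal powr_powr)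
  finally show ?thesis by (simp add: N_def)
qed

text \<open>
  Concentrate \<open>\<psi>\<close> at a single exponent. For a bounded near-extremizer \<open>f\<close> of the constant at
  \<open>(p0, q)\<close>, put \<open>\<psi> p0 = \<parallel>f\<parallel>\<^sub>p\<^sub>0\<close> and let \<open>\<psi>\<close> be a large constant elsewhere. Then the grand norm of \<open>f\<close>
  is at most 1, whereas the infimum in \<open>zeta q\<close> is at most its value at \<open>p0\<close>, so that the norm on
  the sphere is at least \<open>\<parallel>fourier f\<parallel>\<^sub>q / (K p0 q * \<parallel>f\<parallel>\<^sub>p\<^sub>0) > C\<close>.
\<close>
lemma grand_norm_fourier_sharp:
  fixes C :: ennreal
  assumes "C < 1" and p0: "p0 > 1" and "q \<ge> 1" and fin: "restriction_const TYPE('a::euclidean_space) p0 q < \<infinity>"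
  obtains a b \<psi> and f :: "'a::euclidean_space \<Rightarrow> complex" where "1 < a" "a < b" "\<psi> \<in> Psi a b"
    "q \<in> restriction_exponents TYPE('a) a b"
    "f \<in> GLS a b \<psi>" "C * gls_norm a b \<psi> f < sphere_gls_norm a b \<psi> (fourier f)"
proof -
  define K where "K = restriction_const TYPE('a) p0 q"
  have pq: "p0 > 0" "q > 0" using assms by auto
  obtain f :: "'a \<Rightarrow> complex" and M where f: "integrable lebesgue f" "\<And>x. norm (f x) \<le> M"
    and L: "Lp_norm lebesgue p0 f < \<infinity>" "Lp_norm lebesgue p0 f \<noteq> 0"
    and ext: "C * (K * Lp_norm lebesgue p0 f) < Lp_norm sphere_measure q (fourier f)"
    using bounded_near_extremizer[OF \<open>C < 1\<close> fin pq] unfolding K_def by metis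
  define l where "l = enn2real (Lp_norm lebesgue p0 f)"
  have l: "l > 0" "Lp_norm lebesgue p0 f = ennreal l"
    using L by (auto simp: l_def enn2real_positive_iff less_top zero_less_iff_neq_zero)
  define B where "B = max 1 M * max 1 (LINT x|lebesgue. norm (f x))"
  have "1 * 1 \<le> B" unfolding B_def by (intro mult_mono) auto
  then have B: "B \<ge> 1" by simp
  have LpB: "Lp_norm lebesgue p f \<le> ennreal B" if "p \<ge> 1" for p
    unfolding B_def using f that by (intro Lp_norm_bounded_le) (auto simp: le_max_iff_disj)
  \<comment> \<open>Any bounded interval around \<open>p0\<close> with left end above 1 will do.\<close>
  define a where "a = (1 + p0) / 2"
  define b where "b = p0 + 1"
  define \<psi> where "\<psi> p = (if p = p0 then l else B)" for p
  have ab: "1 < a" "a < b" "p0 \<in> {a<..<b}" using p0 by (auto simp: a_def b_def)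
  have \<psi>_pos: "\<psi> p > 0" for p using l B by (simp add: \<psi>_def)
  have \<psi>: "\<psi> \<in> Psi a b"
    unfolding Psi_def
  proof (intro CollectI conjI ballI \<psi>_pos)
    have "\<psi> \<in> borel_measurable borel" unfolding \<psi>_def by measurable
    then show "\<psi> \<in> borel_measurable (lebesgue_on {a<..<b})"
      by (intro measurable_restrict_space1 measurable_completion) auto
    have "min l B \<le> (INF p\<in>{a<..<b}. \<psi> p)"
      using ab by (intro cINF_greatest) (auto simp: \<psi>_def)
    then show "0 < (INF p\<in>{a<..<b}. \<psi> p)" using l B by linarith
  qed
  have q: "q \<in> restriction_exponents TYPE('a) a b"
    using fin ab \<open>q \<ge> 1\<close> by (auto simp: restriction_exponents_def)
  have g1: "gls_norm a b \<psi> f \<le> 1"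
    unfolding gls_norm_def grand_norm_def
  proof (rule SUP_least)
    fix p assume p: "p \<in> {a<..<b}"
    have "Lp_norm lebesgue p f \<le> ennreal (\<psi> p)"
      using LpB[of p] p ab l by (auto simp: \<psi>_def)
    then show "Lp_norm lebesgue p f / ennreal (\<psi> p) \<le> 1"
      by (intro ennreal_divide_leI) auto
  qed
  then have gls: "f \<in> GLS a b \<psi>" using f(1) by (auto simp: GLS_def intro: le_less_trans)
  define z where "z = zeta TYPE('a) a b \<psi> q"
  have z: "z \<le> ennreal l * K"
  proof -
    have "z \<le> ennreal (\<psi> p0) * K"
      unfolding z_def zeta_def K_def by (rule INF_lower) (rule ab)
    then show ?thesis by (simp add: \<psi>_def)
  qed
  have lK: "ennreal l * K \<noteq> \<infinity>"
    using fin by (simp add: K_def ennreal_mult_eq_top_iff)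
  have sph: "Lp_norm sphere_measure q (fourier f) / z \<le> sphere_gls_norm a b \<psi> (fourier f)"
    unfolding sphere_gls_norm_def grand_norm_def z_def using q by (rule SUP_upper)
  have "C * gls_norm a b \<psi> f < sphere_gls_norm a b \<psi> (fourier f)"
  proof (rule ccontr)
    assume "\<not> ?thesis"
    then have "sphere_gls_norm a b \<psi> (fourier f) \<le> C * gls_norm a b \<psi> f" by simp
    also have "\<dots> \<le> C * 1" using g1 by (intro mult_left_mono) auto
    finally have sC: "Lp_norm sphere_measure q (fourier f) / z \<le> C" using sph by simp
    have "Lp_norm sphere_measure q (fourier f) \<le> C * z"
    proof (cases "z = 0")
      case True
      have "Lp_norm sphere_measure q (fourier f) / z = \<infinity>"
        using True ext by (auto simp: ennreal_divide_zero)
      then show ?thesis using sC \<open>C < 1\<close> by (auto simp: top_unique)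
    next
      case False
      have "Lp_norm sphere_measure q (fourier f) / z * z \<le> C * z"
        using sC by (rule mult_right_mono) simp
      moreover have "Lp_norm sphere_measure q (fourier f) / z * z = Lp_norm sphere_measure q (fourier f)"
        using False z lK by (intro ennreal_divide_mult_cancel) (auto simp: top_unique)
      ultimately show ?thesis by simp
    qed
    also have "\<dots> \<le> C * (K * Lp_norm lebesgue p0 f)"
      unfolding l(2) using z by (intro mult_left_mono) (auto simp: mult.commute)
    finally show False using ext by simp
  qed
  then show ?thesis using that ab(1,2) \<psi> q gls by blast
qed

theorem theorem4p1:
  assumes "CARD('n::finite) \<ge> 2"
  shows "(\<forall>a b \<psi>. 1 < a \<and> a < b \<and> \<psi> \<in> Psi a b
              \<and> restriction_exponents TYPE(real ^ 'n) a b \<noteq> {} \<longrightarrow>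
            (\<forall>f \<in> (GLS a b \<psi> :: (real ^ 'n \<Rightarrow> complex) set).
               sphere_gls_norm a b \<psi> (fourier f) \<le> 1 * gls_norm a b \<psi> f))
       \<and> (\<forall>C :: ennreal. C < 1 \<longrightarrow>
            \<not> (\<forall>a b \<psi>. 1 < a \<and> a < b \<and> \<psi> \<in> Psi a b
                  \<and> restriction_exponents TYPE(real ^ 'n) a b \<noteq> {} \<longrightarrow>
                (\<forall>f \<in> (GLS a b \<psi> :: (real ^ 'n \<Rightarrow> complex) set).
                   sphere_gls_norm a b \<psi> (fourier f) \<le> C * gls_norm a b \<psi> f)))"
proof (intro conjI allI impI ballI)
  fix a b :: real and \<psi> and f :: "real ^ 'n \<Rightarrow> complex"
  assume "1 < a \<and> a < b \<and> \<psi> \<in> Psi a b \<and> restriction_exponents TYPE(real ^ 'n) a b \<noteq> {}"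
    and "f \<in> GLS a b \<psi>"
  then show "sphere_gls_norm a b \<psi> (fourier f) \<le> 1 * gls_norm a b \<psi> f"
    by (simp add: grand_norm_fourier_le)
next
  fix C :: ennreal assume C: "C < 1"
  define r where "r = 3 * (real DIM(real ^ 'n) + 2)"
  define p where "p = 2 * r / (2 * r - 1)"
  have "r > 1" by (simp add: r_def)
  then have p: "p > 1" by (simp add: p_def field_simps)
  have fin: "restriction_const TYPE(real ^ 'n) p 2 < \<infinity>"
    unfolding p_def r_def using assms by (intro restriction_const_finite) simp
  obtain a b \<psi> and f :: "real ^ 'n \<Rightarrow> complex"
    where "1 < a" "a < b" "\<psi> \<in> Psi a b" "2 \<in> restriction_exponents TYPE(real ^ 'n) a b"
    "f \<in> GLS a b \<psi>" "C * gls_norm a b \<psi> f < sphere_gls_norm a b \<psi> (fourier f)"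
    by (rule grand_norm_fourier_sharp[OF C p _ fin]) (simp, blast)
  note ex = this
  show "\<not> (\<forall>a b \<psi>. 1 < a \<and> a < b \<and> \<psi> \<in> Psi a b
                  \<and> restriction_exponents TYPE(real ^ 'n) a b \<noteq> {} \<longrightarrow>
                (\<forall>f \<in> (GLS a b \<psi> :: (real ^ 'n \<Rightarrow> complex) set).
                   sphere_gls_norm a b \<psi> (fourier f) \<le> C * gls_norm a b \<psi> f))"
  proof
    assume "\<forall>a b \<psi>. 1 < a \<and> a < b \<and> \<psi> \<in> Psi a b
                  \<and> restriction_exponents TYPE(real ^ 'n) a b \<noteq> {} \<longrightarrow>
                (\<forall>f \<in> (GLS a b \<psi> :: (real ^ 'n \<Rightarrow> complex) set).
                   sphere_gls_norm a b \<psi> (fourier f) \<le> C * gls_norm a b \<psi> f)"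
    then have "sphere_gls_norm a b \<psi> (fourier f) \<le> C * gls_norm a b \<psi> f"
      using ex(1-5) by blast
    then show False using ex(6) by simp
  qed
qed

end
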